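(* Let $G$ be a group, $\Bbbk$ a field and $\rho\colon G\to \operatorname{Sym}(V)$ a permutation representation of $G$ on a set $V$. There exists a $G$-coalgebra $C$ over $\Bbbk$ such that: (1) $G$ acts faithfully on $C$, that is, the action induces a group monomorphism $G\hookrightarrow \operatorname{Aut}(C)$; (2) the image of the restriction map $\operatorname{Aut}(C)\to\operatorname{Sym}\big(G(C)\big)$ is $G$ (that is, the composition $G\hookrightarrow\operatorname{Aut}(C)\to\operatorname{Sym}\big(G(C)\big)$ is an isomorphism of $G$ onto the image of the restriction map); (3) there is a subset $V\subset G(C)$ (a copy of the set $V$) invariant through the $\operatorname{Aut}(C)$-action on $C$ and such that $\rho$ is the composition of the inclusion $G\hookrightarrow\operatorname{Aut}(C)$ with the restriction $\operatorname{Aut}(C)\to\operatorname{Sym}(V)$; and (4) there is a faithful action $\bar{\rho}\colon G\to \operatorname{Sym}\big(G(C)\setminus V\big)$ such that the composition of the inclusion $G\hookrightarrow\operatorname{Aut}(C)$ with the restriction map $\operatorname{Aut}(C)\to\operatorname{Sym}\big(G(C)\big)$ is $\rho\oplus\bar{\rho}$.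
   Context: Groups and sets are arbitrary (possibly infinite). A permutation representation of $G$ on $V$ is a group homomorphism $G\to\operatorname{Sym}(V)$, not necessarily injective, where $\operatorname{Sym}(V)$ is the group of all permutations of $V$. Coalgebras are coassociative and counital. For a coalgebra $(C,\Delta,\varepsilon)$, $G(C)=\{c\in C\mid \Delta(c)=c\otimes c,\ \varepsilon(c)=1\}$ is the set of grouplike elements and $\operatorname{Aut}(C)$ is the group of coalgebra automorphisms; every coalgebra automorphism permutes $G(C)$, which gives the restriction map $\operatorname{Aut}(C)\to\operatorname{Sym}(G(C))$. A $G$-coalgebra is a coalgebra $C$ with an action of $G$ by coalgebra automorphisms, i.e. a homomorphism $G\to\operatorname{Aut}(C)$. For actions $\rho\colon G\to\operatorname{Sym}(A)$ and $\bar\rho\colon G\to\operatorname{Sym}(B)$, $\rho\oplus\bar\rho\colon G\to\operatorname{Sym}(A\sqcup B)$ denotes the action restricting to $\rho$ on $A$ and to $\bar\rho$ on $B$. *)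

theory Defs
  imports "HOL-Algebra.Group_Action" "HOL-Algebra.Module" "HOL-Algebra.AbelCoset"
begin

section \<open>Modules, linear maps and tensor products\<close>

definition mod_hom ::
  "('k, 'n) ring_scheme \<Rightarrow> ('k, 'a, 'p) module_scheme \<Rightarrow> ('k, 'b, 'q) module_scheme \<Rightarrow> ('a \<Rightarrow> 'b) set"
  where "mod_hom R M N = {f \<in> carrier M \<rightarrow> carrier N.
     (\<forall>x\<in>carrier M. \<forall>y\<in>carrier M. f (x \<oplus>\<^bsub>M\<^esub> y) = f x \<oplus>\<^bsub>N\<^esub> f y) \<and>
     (\<forall>a\<in>carrier R. \<forall>x\<in>carrier M. f (a \<odot>\<^bsub>M\<^esub> x) = a \<odot>\<^bsub>N\<^esub> f x)}"

definition self_module :: "('k, 'n) ring_scheme \<Rightarrow> ('k, 'k) module"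
  where "self_module R = \<lparr>carrier = carrier R, mult = mult R, one = one R,
     zero = zero R, add = add R, smult = mult R\<rparr>"

text \<open>The multiplicative fields of the records for the free module and for the tensor product
  are junk: they play no role in the locale \<open>module\<close>.\<close>

definition free_module :: "('k, 'n) ring_scheme \<Rightarrow> 'x set \<Rightarrow> ('k, 'x \<Rightarrow> 'k) module"
  where "free_module R X = \<lparr>
     carrier = {p. (\<forall>z. p z \<in> carrier R) \<and> (\<forall>z. z \<notin> X \<longrightarrow> p z = \<zero>\<^bsub>R\<^esub>) \<and> finite {z. p z \<noteq> \<zero>\<^bsub>R\<^esub>}},
     mult = undefined, one = undefined,
     zero = (\<lambda>_. \<zero>\<^bsub>R\<^esub>),
     add = (\<lambda>p q z. p z \<oplus>\<^bsub>R\<^esub> q z),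
     smult = (\<lambda>a p z. a \<otimes>\<^bsub>R\<^esub> p z)\<rparr>"

definition free_gen :: "('k, 'n) ring_scheme \<Rightarrow> 'x \<Rightarrow> 'x \<Rightarrow> 'k"
  where "free_gen R x = (\<lambda>z. if z = x then \<one>\<^bsub>R\<^esub> else \<zero>\<^bsub>R\<^esub>)"

definition bilinear_relations ::
  "('k, 'n) ring_scheme \<Rightarrow> ('k, 'a, 'p) module_scheme \<Rightarrow> ('k, 'b, 'q) module_scheme \<Rightarrow> ('a \<times> 'b \<Rightarrow> 'k) set"
  where "bilinear_relations R M N =
    (let F = free_module R (carrier M \<times> carrier N); e = (\<lambda>x y. free_gen R (x, y)) in
      {e (x \<oplus>\<^bsub>M\<^esub> x') y \<ominus>\<^bsub>F\<^esub> (e x y \<oplus>\<^bsub>F\<^esub> e x' y) | x x' y.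
         x \<in> carrier M \<and> x' \<in> carrier M \<and> y \<in> carrier N} \<union>
      {e x (y \<oplus>\<^bsub>N\<^esub> y') \<ominus>\<^bsub>F\<^esub> (e x y \<oplus>\<^bsub>F\<^esub> e x y') | x y y'.
         x \<in> carrier M \<and> y \<in> carrier N \<and> y' \<in> carrier N} \<union>
      {e (a \<odot>\<^bsub>M\<^esub> x) y \<ominus>\<^bsub>F\<^esub> (a \<odot>\<^bsub>F\<^esub> e x y) | a x y.
         a \<in> carrier R \<and> x \<in> carrier M \<and> y \<in> carrier N} \<union>
      {e x (a \<odot>\<^bsub>N\<^esub> y) \<ominus>\<^bsub>F\<^esub> (a \<odot>\<^bsub>F\<^esub> e x y) | a x y.
         a \<in> carrier R \<and> x \<in> carrier M \<and> y \<in> carrier N})"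

definition tensor_kernel ::
  "('k, 'n) ring_scheme \<Rightarrow> ('k, 'a, 'p) module_scheme \<Rightarrow> ('k, 'b, 'q) module_scheme \<Rightarrow> ('a \<times> 'b \<Rightarrow> 'k) set"
  where "tensor_kernel R M N =
    \<Inter> {H. submodule H R (free_module R (carrier M \<times> carrier N)) \<and> bilinear_relations R M N \<subseteq> H}"

text \<open>The tensor product is the quotient of the free module on the set of pairs by the submodule
  generated by the bilinear relations; its elements are cosets.\<close>

definition tensor_product ::
  "('k, 'n) ring_scheme \<Rightarrow> ('k, 'a, 'p) module_scheme \<Rightarrow> ('k, 'b, 'q) module_scheme \<Rightarrow>
     ('k, ('a \<times> 'b \<Rightarrow> 'k) set) module"
  where "tensor_product R M N =
    (let F = free_module R (carrier M \<times> carrier N); H = tensor_kernel R M N in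
     \<lparr>carrier = a_rcosets\<^bsub>F\<^esub> H,
      mult = undefined, one = undefined,
      zero = H,
      add = (\<lambda>A B. A <+>\<^bsub>F\<^esub> B),
      smult = (\<lambda>a A. \<Union>p\<in>A. H +>\<^bsub>F\<^esub> (a \<odot>\<^bsub>F\<^esub> p))\<rparr>)"

definition pure_tensor ::
  "('k, 'n) ring_scheme \<Rightarrow> ('k, 'a, 'p) module_scheme \<Rightarrow> ('k, 'b, 'q) module_scheme \<Rightarrow>
     'a \<Rightarrow> 'b \<Rightarrow> ('a \<times> 'b \<Rightarrow> 'k) set"
  where "pure_tensor R M N x y =
    tensor_kernel R M N +>\<^bsub>free_module R (carrier M \<times> carrier N)\<^esub> free_gen R (x, y)"

text \<open>The linear map from the tensor product to \<open>P\<close> induced by a bilinear map \<open>b\<close>: extend \<open>b\<close>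
  linearly to the free module and descend to cosets. For bilinear \<open>b\<close> the extension is constant on
  each coset, so its image is a singleton; otherwise the value is junk.\<close>

definition tensor_lift ::
  "('k, 'n) ring_scheme \<Rightarrow> ('k, 'c, 'r) module_scheme \<Rightarrow> ('a \<Rightarrow> 'b \<Rightarrow> 'c) \<Rightarrow> ('a \<times> 'b \<Rightarrow> 'k) set \<Rightarrow> 'c"
  where "tensor_lift R P b A =
    the_elem ((\<lambda>p. \<Oplus>\<^bsub>P\<^esub>z\<in>{z. p z \<noteq> \<zero>\<^bsub>R\<^esub>}. p z \<odot>\<^bsub>P\<^esub> b (fst z) (snd z)) ` A)"

text \<open>\<open>tensor_map R M' N' f g\<close> is \<open>f \<otimes> g\<close>, where \<open>M'\<close> and \<open>N'\<close> are the codomains of \<open>f\<close> and \<open>g\<close>.\<close>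

definition tensor_map ::
  "('k, 'n) ring_scheme \<Rightarrow> ('k, 'c, 'p) module_scheme \<Rightarrow> ('k, 'd, 'q) module_scheme \<Rightarrow>
     ('a \<Rightarrow> 'c) \<Rightarrow> ('b \<Rightarrow> 'd) \<Rightarrow> ('a \<times> 'b \<Rightarrow> 'k) set \<Rightarrow> ('c \<times> 'd \<Rightarrow> 'k) set"
  where "tensor_map R M' N' f g =
    tensor_lift R (tensor_product R M' N') (\<lambda>x y. pure_tensor R M' N' (f x) (g y))"

text \<open>The associator sends \<open>(x \<otimes> y) \<otimes> z\<close> to \<open>x \<otimes> (y \<otimes> z)\<close>.\<close>

definition tensor_assoc ::
  "('k, 'n) ring_scheme \<Rightarrow> ('k, 'a, 'p) module_scheme \<Rightarrow> ('k, 'b, 'q) module_scheme \<Rightarrow>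
     ('k, 'c, 'r) module_scheme \<Rightarrow>
     (('a \<times> 'b \<Rightarrow> 'k) set \<times> 'c \<Rightarrow> 'k) set \<Rightarrow> ('a \<times> ('b \<times> 'c \<Rightarrow> 'k) set \<Rightarrow> 'k) set"
  where "tensor_assoc R L M N =
    (let MN = tensor_product R M N; T = tensor_product R L MN in
      tensor_lift R T (\<lambda>t z.
        tensor_lift R T (\<lambda>x y. pure_tensor R L MN x (pure_tensor R M N y z)) t))"


section \<open>Coalgebras\<close>

record ('k, 'c) coalgebra = "('k, 'c) module" +
  comult :: "'c \<Rightarrow> ('c \<times> 'c \<Rightarrow> 'k) set"
  counit :: "'c \<Rightarrow> 'k"

locale coalgebra = module K C for K (structure) and C (structure) +
  assumes comult_hom: "comult C \<in> mod_hom K C (tensor_product K C C)"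
    and counit_hom: "counit C \<in> mod_hom K C (self_module K)"
    and coassoc: "c \<in> carrier C \<Longrightarrow>
      tensor_assoc K C C C (tensor_map K (tensor_product K C C) C (comult C) (\<lambda>x. x) (comult C c)) =
      tensor_map K C (tensor_product K C C) (\<lambda>x. x) (comult C) (comult C c)"
    and counit_left: "c \<in> carrier C \<Longrightarrow>
      tensor_map K (self_module K) C (counit C) (\<lambda>x. x) (comult C c) =
      pure_tensor K (self_module K) C \<one> c"
    and counit_right: "c \<in> carrier C \<Longrightarrow>
      tensor_map K C (self_module K) (\<lambda>x. x) (counit C) (comult C c) =
      pure_tensor K C (self_module K) c \<one>"

definition coalg_hom ::
  "('k, 'n) ring_scheme \<Rightarrow> ('k, 'c, 'p) coalgebra_scheme \<Rightarrow> ('k, 'd, 'q) coalgebra_scheme \<Rightarrow> ('c \<Rightarrow> 'd) set"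
  where "coalg_hom K C D = {f \<in> mod_hom K C D.
     (\<forall>c\<in>carrier C. comult D (f c) = tensor_map K D D f f (comult C c)) \<and>
     (\<forall>c\<in>carrier C. counit D (f c) = counit C c)}"

definition coalg_Aut ::
  "('k, 'n) ring_scheme \<Rightarrow> ('k, 'c, 'p) coalgebra_scheme \<Rightarrow> ('c \<Rightarrow> 'c) monoid"
  where "coalg_Aut K C = BijGroup (carrier C) \<lparr>carrier := coalg_hom K C C \<inter> Bij (carrier C)\<rparr>"

definition grouplikes :: "('k, 'n) ring_scheme \<Rightarrow> ('k, 'c, 'p) coalgebra_scheme \<Rightarrow> 'c set"
  where "grouplikes K C =
    {c \<in> carrier C. comult C c = pure_tensor K C C c c \<and> counit C c = \<one>\<^bsub>K\<^esub>}"

definition grouplike_restriction ::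
  "('k, 'n) ring_scheme \<Rightarrow> ('k, 'c, 'p) coalgebra_scheme \<Rightarrow> ('c \<Rightarrow> 'c) \<Rightarrow> 'c \<Rightarrow> 'c"
  where "grouplike_restriction K C f = restrict f (grouplikes K C)"

locale G_coalgebra = coalgebra K C + group_hom G "coalg_Aut K C" \<alpha>
  for G (structure) and K (structure) and C (structure) and \<alpha>


section \<open>Permutation representations\<close>

text \<open>Transport of an action on \<open>V\<close> to the copy \<open>\<iota> ` V\<close> of \<open>V\<close>, for \<open>\<iota>\<close> injective on \<open>V\<close>.\<close>

definition transport_action :: "('v \<Rightarrow> 'w) \<Rightarrow> 'v set \<Rightarrow> ('g \<Rightarrow> 'v \<Rightarrow> 'v) \<Rightarrow> 'g \<Rightarrow> 'w \<Rightarrow> 'w"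
  where "transport_action \<iota> V \<rho> g = (\<lambda>w\<in>\<iota> ` V. \<iota> (\<rho> g (inv_into V \<iota> w)))"

text \<open>The sum of actions on subsets \<open>A\<close> and \<open>B\<close> of a common type, meant for disjoint \<open>A\<close> and \<open>B\<close>.\<close>

definition sum_action ::
  "'w set \<Rightarrow> ('g \<Rightarrow> 'w \<Rightarrow> 'w) \<Rightarrow> 'w set \<Rightarrow> ('g \<Rightarrow> 'w \<Rightarrow> 'w) \<Rightarrow> 'g \<Rightarrow> 'w \<Rightarrow> 'w"
  where "sum_action A \<rho> B \<sigma> g = (\<lambda>w\<in>A \<union> B. if w \<in> A then \<rho> g w else \<sigma> g w)"

end

theory Submission
  imports Defs
begin

text \<open>The coalgebra with basis the vertices and arrows of a quiver, in which vertices are grouplike and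
  an arrow \<open>x\<close> from \<open>v\<close> to \<open>w\<close> has \<open>\<Delta>(x) = v \<otimes> x + x \<otimes> w\<close>, has exactly the vertices as its grouplike
  elements. Its nontrivial skew primitives detect the arrows, so its automorphisms restrict on
  vertices to the automorphisms of the underlying directed graph. It remains to find such a graph
  with automorphism group \<open>G\<close> that contains \<open>V\<close> as an invariant set of vertices. Let \<open>X\<close> be the
  disjoint union of \<open>G\<close> and \<open>V\<close>, acted on by left translation and by \<open>\<rho>\<close>. The graph consists of \<open>X\<close>
  and of one copy \<open>{x} \<times> X\<close> of a fixed well-order of \<open>X\<close> for each \<open>x \<in> G\<close>, with an arrow from \<open>(x, c)\<close>
  to \<open>x \<cdot> c\<close>. Since well-orders are rigid, an automorphism permutes the copies, and it acts on \<open>X\<close> as the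
  element of \<open>G\<close> to which it sends the copy indexed by \<open>1\<close>.\<close>

section \<open>Linear maps\<close>

text \<open>The arrows are not canonical. If \<open>x\<close> is an arrow from \<open>v\<close> to
  \<open>w\<close>, then sending \<open>x\<close> to \<open>a x + b (v - w)\<close> with
  \<open>a \<noteq> 0\<close>, and fixing the rest of the basis, is an automorphism. So Aut(C) is
  strictly larger than the image of \<open>G\<close>, and only its restriction to the vertices can
  be compared with \<open>G\<close>. What survives is whether two vertices are joined by an arrow,
  and the graph has to be rigid through adjacency alone.

  The summand \<open>G\<close> of \<open>X\<close> is there because \<rho> may be far from faithful;
  the regular orbit separates group elements outside \<open>V\<close>. Aiming the arrow of
  \<open>(x, c)\<close> at \<open>x \<cdot> c\<close> is compatible with translating the index,
  since \<open>g (x \<cdot> c) = (g x) \<cdot> c\<close>. The arrows out of the copy of index 1 show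
  how an automorphism moves \<open>X\<close>. Those out of the points \<open>(x, 1)\<close> end at
  \<open>x\<close> itself and show that indices move in the same way. A well-order is the pattern of
  the copies because it exists on sets of any cardinality, is rigid, and makes all points
  comparable, so that no copy can be torn apart.\<close>

lemma mod_homI:
  assumes "\<And>x. x \<in> carrier M \<Longrightarrow> f x \<in> carrier N"
    and "\<And>x y. x \<in> carrier M \<Longrightarrow> y \<in> carrier M \<Longrightarrow> f (x \<oplus>\<^bsub>M\<^esub> y) = f x \<oplus>\<^bsub>N\<^esub> f y"
    and "\<And>a x. a \<in> carrier R \<Longrightarrow> x \<in> carrier M \<Longrightarrow> f (a \<odot>\<^bsub>M\<^esub> x) = a \<odot>\<^bsub>N\<^esub> f x"
  shows "f \<in> mod_hom R M N"
  using assms by (auto simp: mod_hom_def)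

lemma mod_hom_closed: "f \<in> mod_hom R M N \<Longrightarrow> x \<in> carrier M \<Longrightarrow> f x \<in> carrier N"
  by (auto simp: mod_hom_def)

lemma mod_hom_add:
  "f \<in> mod_hom R M N \<Longrightarrow> x \<in> carrier M \<Longrightarrow> y \<in> carrier M \<Longrightarrow> f (x \<oplus>\<^bsub>M\<^esub> y) = f x \<oplus>\<^bsub>N\<^esub> f y"
  by (auto simp: mod_hom_def)

lemma mod_hom_smult:
  "f \<in> mod_hom R M N \<Longrightarrow> a \<in> carrier R \<Longrightarrow> x \<in> carrier M \<Longrightarrow> f (a \<odot>\<^bsub>M\<^esub> x) = a \<odot>\<^bsub>N\<^esub> f x"
  by (auto simp: mod_hom_def)

lemma mod_hom_id: "(\<lambda>x. x) \<in> mod_hom R M M"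
  by (rule mod_homI) auto

lemma mod_hom_comp:
  "g \<in> mod_hom R N P \<Longrightarrow> f \<in> mod_hom R M N \<Longrightarrow> (\<lambda>x. g (f x)) \<in> mod_hom R M P"
  by (rule mod_homI) (auto simp: mod_hom_closed mod_hom_add mod_hom_smult)

lemma mod_hom_cong:
  assumes "f \<in> mod_hom R M N" "\<And>x. x \<in> carrier M \<Longrightarrow> f x = g x" "module R M"
  shows "g \<in> mod_hom R M N"
proof -
  interpret module R M by fact
  show ?thesis
    using assms(1) assms(2)[symmetric]
    by (intro mod_homI) (auto simp: mod_hom_closed mod_hom_add mod_hom_smult)
qed

lemma module_cring: "module R M \<Longrightarrow> cring R"
  by (simp add: module_def)

lemma mod_hom_zero:
  assumes "module R M" "module R N" "f \<in> mod_hom R M N"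
  shows "f \<zero>\<^bsub>M\<^esub> = \<zero>\<^bsub>N\<^esub>"
proof -
  interpret M: module R M by fact
  interpret N: module R N by fact
  have "f (\<zero>\<^bsub>R\<^esub> \<odot>\<^bsub>M\<^esub> \<zero>\<^bsub>M\<^esub>) = \<zero>\<^bsub>R\<^esub> \<odot>\<^bsub>N\<^esub> f \<zero>\<^bsub>M\<^esub>"
    using assms(3) by (intro mod_hom_smult) auto
  then show ?thesis
    using mod_hom_closed[OF assms(3) M.M.zero_closed] by simp
qed

lemma mod_hom_minus:
  assumes "module R M" "module R N" "f \<in> mod_hom R M N" "x \<in> carrier M"
  shows "f (\<ominus>\<^bsub>M\<^esub> x) = \<ominus>\<^bsub>N\<^esub> f x"
proof -
  interpret M: module R M by fact
  interpret N: module R N by fact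
  have "f ((\<ominus>\<^bsub>R\<^esub> \<one>\<^bsub>R\<^esub>) \<odot>\<^bsub>M\<^esub> x) = (\<ominus>\<^bsub>R\<^esub> \<one>\<^bsub>R\<^esub>) \<odot>\<^bsub>N\<^esub> f x"
    using assms by (intro mod_hom_smult) auto
  then show ?thesis
    using mod_hom_closed[OF assms(3,4)] assms(4)
    by (simp add: M.smult_l_minus N.smult_l_minus)
qed

text \<open>The bilinear relations are given as differences; this turns the vanishing of a map on
  such a difference into an equation between two values.\<close>

lemma mod_hom_diff_eq_zero_iff:
  assumes "module R M" "module R N" "f \<in> mod_hom R M N" "x \<in> carrier M" "y \<in> carrier M"
  shows "f (x \<ominus>\<^bsub>M\<^esub> y) = \<zero>\<^bsub>N\<^esub> \<longleftrightarrow> f x = f y"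
proof -
  interpret M: module R M by fact
  interpret N: module R N by fact
  have "f (x \<ominus>\<^bsub>M\<^esub> y) = f x \<ominus>\<^bsub>N\<^esub> f y"
    using assms by (simp add: M.M.minus_eq N.M.minus_eq mod_hom_add mod_hom_minus)
  then show ?thesis
    using mod_hom_closed[OF assms(3)] assms(4,5) by (metis N.M.minus_closed N.M.r_neg N.M.minus_eq N.M.minus_equality N.M.minus_minus N.M.a_inv_closed)
qed

lemma mod_hom_zero_map:
  assumes "module R N" shows "(\<lambda>x. \<zero>\<^bsub>N\<^esub>) \<in> mod_hom R M N"
proof -
  interpret module R N by fact
  show ?thesis by (rule mod_homI) auto
qed

lemma mod_hom_sum:
  assumes "module R N" "f \<in> mod_hom R M N" "g \<in> mod_hom R M N"
  shows "(\<lambda>x. f x \<oplus>\<^bsub>N\<^esub> g x) \<in> mod_hom R M N"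
proof -
  interpret module R N by fact
  show ?thesis
    using assms
    by (intro mod_homI) (auto simp: mod_hom_closed mod_hom_add mod_hom_smult smult_r_distr M.a_ac)
qed

lemma mod_hom_scale:
  assumes "module R N" "f \<in> mod_hom R M N" "a \<in> carrier R"
  shows "(\<lambda>x. a \<odot>\<^bsub>N\<^esub> f x) \<in> mod_hom R M N"
proof -
  interpret module R N by fact
  show ?thesis
    using assms
    by (intro mod_homI)
      (auto simp: mod_hom_closed mod_hom_add mod_hom_smult smult_r_distr
        smult_assoc1[symmetric] R.m_comm)
qed

lemma (in module) mod_hom_kernel_submodule:
  assumes "module R N" "f \<in> mod_hom R M N"
  shows "submodule {x \<in> carrier M. f x = \<zero>\<^bsub>N\<^esub>} R M"
proof -
  interpret N: module R N by fact
  show ?thesis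
    using assms module_axioms
    by (intro submoduleI) (auto simp: mod_hom_zero mod_hom_minus mod_hom_add mod_hom_smult)
qed

text \<open>A coalgebra record extends a module record and so is a different object; its module
  structure is inherited through the fields that the two have in common.\<close>

lemma module_fields_cong:
  assumes "module R M" "carrier N = carrier M" "zero N = zero M" "add N = add M" "smult N = smult M"
  shows "module R N"
proof -
  interpret M: module R M by fact
  have eqs: "carrier N = carrier M" "\<zero>\<^bsub>N\<^esub> = \<zero>\<^bsub>M\<^esub>" "x \<oplus>\<^bsub>N\<^esub> y = x \<oplus>\<^bsub>M\<^esub> y" "a \<odot>\<^bsub>N\<^esub> x = a \<odot>\<^bsub>M\<^esub> x" for a x y
    using assms by simp_all
  show ?thesis
    using module_cring[OF assms(1)] M.M.l_neg M.M.a_inv_closed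
    by (intro moduleI abelian_groupI)
      (auto simp: eqs M.M.a_ac M.smult_l_distr M.smult_r_distr M.smult_assoc1)
qed

lemma self_module_module:
  assumes "cring R" shows "module R (self_module R)"
proof -
  interpret cring R by fact
  show ?thesis
  proof (intro moduleI abelian_groupI)
    show "\<exists>y\<in>carrier (self_module R). y \<oplus>\<^bsub>self_module R\<^esub> x = \<zero>\<^bsub>self_module R\<^esub>"
      if "x \<in> carrier (self_module R)" for x
      using that l_neg by (auto simp: self_module_def)
  qed (auto simp: self_module_def assms a_ac l_distr r_distr m_assoc)
qed


section \<open>Free modules\<close>

lemma free_module_simps [simp]:
  "\<zero>\<^bsub>free_module R X\<^esub> = (\<lambda>_. \<zero>\<^bsub>R\<^esub>)"
  "p \<oplus>\<^bsub>free_module R X\<^esub> q = (\<lambda>z. p z \<oplus>\<^bsub>R\<^esub> q z)"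
  "a \<odot>\<^bsub>free_module R X\<^esub> p = (\<lambda>z. a \<otimes>\<^bsub>R\<^esub> p z)"
  by (simp_all add: free_module_def)

lemma mem_free_module_iff:
  "p \<in> carrier (free_module R X) \<longleftrightarrow>
    (\<forall>z. p z \<in> carrier R) \<and> (\<forall>z. z \<notin> X \<longrightarrow> p z = \<zero>\<^bsub>R\<^esub>) \<and> finite {z. p z \<noteq> \<zero>\<^bsub>R\<^esub>}"
  by (simp add: free_module_def)

lemma free_module_module:
  assumes "cring R" shows "module R (free_module R X)"
proof -
  interpret cring R by fact
  have add: "(\<lambda>z. p z \<oplus>\<^bsub>R\<^esub> q z) \<in> carrier (free_module R X)"
    if "p \<in> carrier (free_module R X)" "q \<in> carrier (free_module R X)" for p q
  proof -
    have "{z. p z \<oplus>\<^bsub>R\<^esub> q z \<noteq> \<zero>\<^bsub>R\<^esub>} \<subseteq> {z. p z \<noteq> \<zero>\<^bsub>R\<^esub>} \<union> {z. q z \<noteq> \<zero>\<^bsub>R\<^esub>}"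
      by auto
    then show ?thesis
      using that by (auto simp: mem_free_module_iff elim: finite_subset)
  qed
  have smult: "(\<lambda>z. a \<otimes>\<^bsub>R\<^esub> p z) \<in> carrier (free_module R X)"
    if "p \<in> carrier (free_module R X)" "a \<in> carrier R" for p a
  proof -
    have "{z. a \<otimes>\<^bsub>R\<^esub> p z \<noteq> \<zero>\<^bsub>R\<^esub>} \<subseteq> {z. p z \<noteq> \<zero>\<^bsub>R\<^esub>}"
      using that by auto
    then show ?thesis
      using that by (auto simp: mem_free_module_iff elim: finite_subset)
  qed
  have inv: "\<exists>q\<in>carrier (free_module R X). (\<lambda>z. q z \<oplus>\<^bsub>R\<^esub> p z) = (\<lambda>_. \<zero>\<^bsub>R\<^esub>)"
    if "p \<in> carrier (free_module R X)" for p
    using smult[OF that, of "\<ominus>\<^bsub>R\<^esub> \<one>\<^bsub>R\<^esub>"] that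
    by (intro bexI[of _ "\<lambda>z. \<ominus>\<^bsub>R\<^esub> \<one>\<^bsub>R\<^esub> \<otimes>\<^bsub>R\<^esub> p z"])
       (auto simp: l_minus l_neg mem_free_module_iff)
  have val: "p z \<in> carrier R" if "p \<in> carrier (free_module R X)" for p z
    using that by (simp add: mem_free_module_iff)
  have zero: "(\<lambda>_. \<zero>\<^bsub>R\<^esub>) \<in> carrier (free_module R X)"
    by (simp add: mem_free_module_iff)
  show ?thesis
    by (intro moduleI abelian_groupI)
      (use inv in \<open>simp_all add: assms add smult zero val fun_eq_iff a_ac l_distr r_distr m_assoc\<close>)
qed

lemma free_gen_same [simp]: "free_gen R x x = \<one>\<^bsub>R\<^esub>"
  and free_gen_other [simp]: "z \<noteq> x \<Longrightarrow> free_gen R x z = \<zero>\<^bsub>R\<^esub>"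
  by (simp_all add: free_gen_def)

lemma free_gen_closed:
  assumes "cring R" "x \<in> X" shows "free_gen R x \<in> carrier (free_module R X)"
proof -
  interpret cring R by fact
  have "{z. free_gen R x z \<noteq> \<zero>\<^bsub>R\<^esub>} \<subseteq> {x}"
    by (auto simp: free_gen_def)
  then have "finite {z. free_gen R x z \<noteq> \<zero>\<^bsub>R\<^esub>}"
    by (rule finite_subset) simp
  then show ?thesis
    using assms(2) by (auto simp: mem_free_module_iff free_gen_def)
qed

lemma free_gen_eq_iff: "\<one>\<^bsub>R\<^esub> \<noteq> \<zero>\<^bsub>R\<^esub> \<Longrightarrow> free_gen R x = free_gen R y \<longleftrightarrow> x = y"
  by (auto simp: free_gen_def fun_eq_iff split: if_splits)

lemma free_module_hom_eq:
  assumes R: "cring R" and f: "f \<in> mod_hom R (free_module R X) P" and g: "g \<in> mod_hom R (free_module R X) P"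
    and P: "module R P"
    and eq: "\<And>x. x \<in> X \<Longrightarrow> f (free_gen R x) = g (free_gen R x)"
    and p: "p \<in> carrier (free_module R X)"
  shows "f p = g p"
proof -
  interpret cring R by fact
  interpret F: module R "free_module R X" by (rule free_module_module[OF R])
  \<comment> \<open>The induction runs over a finite set that bounds the support, for all
    \<open>p\<close> at once, because deleting the coefficient at \<open>x\<close> changes the
    vector.\<close>
  have *: "\<forall>p\<in>carrier (free_module R X). {z. p z \<noteq> \<zero>\<^bsub>R\<^esub>} \<subseteq> S \<longrightarrow> f p = g p" if "finite S" for S
    using that
  proof (induction S rule: finite_induct)
    case empty
    have "p = \<zero>\<^bsub>free_module R X\<^esub>" if "{z. p z \<noteq> \<zero>\<^bsub>R\<^esub>} \<subseteq> {}" for p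
      using that by auto
    then show ?case
      using mod_hom_zero[OF F.module_axioms P f] mod_hom_zero[OF F.module_axioms P g] by metis
  next
    case (insert x S)
    show ?case
    proof (intro ballI impI)
      fix p assume p: "p \<in> carrier (free_module R X)" and supp: "{z. p z \<noteq> \<zero>\<^bsub>R\<^esub>} \<subseteq> insert x S"
      show "f p = g p"
      proof (cases "x \<in> X")
        case False
        then have "{z. p z \<noteq> \<zero>\<^bsub>R\<^esub>} \<subseteq> S"
          using supp p by (auto simp: mem_free_module_iff)
        then show ?thesis using insert.IH p by blast
      next
        case True
        define q where "q = p(x := \<zero>\<^bsub>R\<^esub>)"
        have "{z. q z \<noteq> \<zero>\<^bsub>R\<^esub>} \<subseteq> {z. p z \<noteq> \<zero>\<^bsub>R\<^esub>}"
          by (auto simp: q_def)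
        then have "finite {z. q z \<noteq> \<zero>\<^bsub>R\<^esub>}"
          using p by (auto simp: mem_free_module_iff intro: rev_finite_subset)
        then have q: "q \<in> carrier (free_module R X)"
          using p by (simp add: mem_free_module_iff q_def)
        have qs: "{z. q z \<noteq> \<zero>\<^bsub>R\<^esub>} \<subseteq> S"
          using supp by (auto simp: q_def)
        have px: "p x \<in> carrier R" and gen: "free_gen R x \<in> carrier (free_module R X)"
          using p True R by (simp_all add: mem_free_module_iff[of p] free_gen_closed)
        have split: "p = q \<oplus>\<^bsub>free_module R X\<^esub> (p x \<odot>\<^bsub>free_module R X\<^esub> free_gen R x)"
          using p by (auto simp: q_def mem_free_module_iff free_gen_def fun_eq_iff)
        have cl: "p x \<odot>\<^bsub>free_module R X\<^esub> free_gen R x \<in> carrier (free_module R X)"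
          using F.smult_closed px gen .
        have "f p = f q \<oplus>\<^bsub>P\<^esub> p x \<odot>\<^bsub>P\<^esub> f (free_gen R x)"
          by (subst split, subst mod_hom_add[OF f q cl], subst mod_hom_smult[OF f px gen]) (rule refl)
        also have "\<dots> = g q \<oplus>\<^bsub>P\<^esub> p x \<odot>\<^bsub>P\<^esub> g (free_gen R x)"
          using insert.IH q qs eq True by simp
        also have "\<dots> = g p"
          by (subst (2) split, subst mod_hom_add[OF g q cl], subst mod_hom_smult[OF g px gen]) (rule refl)
        finally show ?thesis .
      qed
    qed
  qed
  show ?thesis
    using *[of "{z. p z \<noteq> \<zero>\<^bsub>R\<^esub>}"] p by (simp add: mem_free_module_iff)
qed

text \<open>The sum inside \<open>tensor_lift\<close>, separated from the passage to cosets. It also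
  provides the comultiplication and counit of a quiver and the linear extension of a group
  action.\<close>

definition free_lift ::
  "('k, 'n) ring_scheme \<Rightarrow> ('k, 'c, 'r) module_scheme \<Rightarrow> ('x \<Rightarrow> 'c) \<Rightarrow> ('x \<Rightarrow> 'k) \<Rightarrow> 'c"
  where "free_lift R P b p = (\<Oplus>\<^bsub>P\<^esub>z\<in>{z. p z \<noteq> \<zero>\<^bsub>R\<^esub>}. p z \<odot>\<^bsub>P\<^esub> b z)"

context
  fixes R :: "('k, 'n) ring_scheme" and P :: "('k, 'c, 'r) module_scheme" and b :: "'x \<Rightarrow> 'c" and X
  assumes P: "module R P" and b: "b \<in> X \<rightarrow> carrier P"
begin

interpretation P: module R P by (rule P)

text \<open>Linearity compares sums over the supports of different vectors. Zero coefficients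
  contribute nothing, so all these sums may be taken over one finite set, kept inside
  \<open>X\<close>, where \<open>b\<close> takes values in \<open>P\<close>.\<close>

lemma free_lift_superset:
  assumes p: "p \<in> carrier (free_module R X)" and S: "finite S" "{z. p z \<noteq> \<zero>\<^bsub>R\<^esub>} \<subseteq> S" "S \<subseteq> X"
  shows "free_lift R P b p = (\<Oplus>\<^bsub>P\<^esub>z\<in>S. p z \<odot>\<^bsub>P\<^esub> b z)"
proof -
  have pb: "p z \<in> carrier R" "b z \<in> carrier P" if "z \<in> S" for z
    using that S(3) b p by (auto simp: mem_free_module_iff)
  show ?thesis
    unfolding free_lift_def using S(1,2) pb
    by (intro P.M.add.finprod_mono_neutral_cong_left) auto
qed

lemma free_lift_hom: "free_lift R P b \<in> mod_hom R (free_module R X) P"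
proof (rule mod_homI)
  interpret F: module R "free_module R X" by (rule free_module_module[OF module_cring[OF P]])
  fix p assume p: "p \<in> carrier (free_module R X)"
  let ?S = "{z. p z \<noteq> \<zero>\<^bsub>R\<^esub>}"
  have S: "finite ?S" "?S \<subseteq> X"
    using p by (auto simp: mem_free_module_iff)
  have bS: "b z \<in> carrier P" if "p z \<noteq> \<zero>\<^bsub>R\<^esub>" for z
    using that S(2) b by auto
  have pS: "(\<lambda>z. p z \<odot>\<^bsub>P\<^esub> b z) \<in> ?S \<rightarrow> carrier P"
    using p bS by (auto simp: mem_free_module_iff)
  show "free_lift R P b p \<in> carrier P"
    unfolding free_lift_def using pS by (rule P.M.finsum_closed)
  have pv: "p z \<in> carrier R" for z
    using p by (simp add: mem_free_module_iff)
  show "free_lift R P b (a \<odot>\<^bsub>free_module R X\<^esub> p) = a \<odot>\<^bsub>P\<^esub> free_lift R P b p"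
    if a: "a \<in> carrier R" for a
  proof -
    have sub: "{z. (a \<odot>\<^bsub>free_module R X\<^esub> p) z \<noteq> \<zero>\<^bsub>R\<^esub>} \<subseteq> ?S"
      using a by auto
    have "free_lift R P b (a \<odot>\<^bsub>free_module R X\<^esub> p) = (\<Oplus>\<^bsub>P\<^esub>z\<in>?S. (a \<odot>\<^bsub>free_module R X\<^esub> p) z \<odot>\<^bsub>P\<^esub> b z)"
      by (rule free_lift_superset[OF F.smult_closed[OF a p] S(1) sub S(2)])
    also have "\<dots> = (\<Oplus>\<^bsub>P\<^esub>z\<in>?S. a \<odot>\<^bsub>P\<^esub> (p z \<odot>\<^bsub>P\<^esub> b z))"
      by (intro P.M.finsum_cong') (simp_all add: Pi_iff a pv bS P.smult_assoc1)
    also have "\<dots> = a \<odot>\<^bsub>P\<^esub> free_lift R P b p"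
      unfolding free_lift_def using P.finsum_smult_ldistr[OF S(1) a pS] by simp
    finally show ?thesis .
  qed
  show "free_lift R P b (p \<oplus>\<^bsub>free_module R X\<^esub> q) = free_lift R P b p \<oplus>\<^bsub>P\<^esub> free_lift R P b q"
    if q: "q \<in> carrier (free_module R X)" for q
  proof -
    let ?S' = "?S \<union> {z. q z \<noteq> \<zero>\<^bsub>R\<^esub>}"
    have S': "finite ?S'" "?S' \<subseteq> X"
      using p q by (auto simp: mem_free_module_iff)
    have qv: "q z \<in> carrier R" for z
      using q by (simp add: mem_free_module_iff)
    have bS': "b z \<in> carrier P" if "z \<in> ?S'" for z
      using that S'(2) b by blast
    have sub: "{z. (p \<oplus>\<^bsub>free_module R X\<^esub> q) z \<noteq> \<zero>\<^bsub>R\<^esub>} \<subseteq> ?S'"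
      by auto
    have "free_lift R P b (p \<oplus>\<^bsub>free_module R X\<^esub> q) =
        (\<Oplus>\<^bsub>P\<^esub>z\<in>?S'. (p \<oplus>\<^bsub>free_module R X\<^esub> q) z \<odot>\<^bsub>P\<^esub> b z)"
      by (rule free_lift_superset[OF F.M.a_closed[OF p q] S'(1) sub S'(2)])
    also have "\<dots> = (\<Oplus>\<^bsub>P\<^esub>z\<in>?S'. p z \<odot>\<^bsub>P\<^esub> b z \<oplus>\<^bsub>P\<^esub> q z \<odot>\<^bsub>P\<^esub> b z)"
      by (intro P.M.finsum_cong' refl funcsetI)
        (simp_all only: free_module_simps P.smult_l_distr pv qv bS' P.smult_closed P.M.a_closed)
    also have "\<dots> = (\<Oplus>\<^bsub>P\<^esub>z\<in>?S'. p z \<odot>\<^bsub>P\<^esub> b z) \<oplus>\<^bsub>P\<^esub> (\<Oplus>\<^bsub>P\<^esub>z\<in>?S'. q z \<odot>\<^bsub>P\<^esub> b z)"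
      by (intro P.M.finsum_addf funcsetI) (simp_all only: pv qv bS' P.smult_closed)
    also have "\<dots> = free_lift R P b p \<oplus>\<^bsub>P\<^esub> free_lift R P b q"
      using free_lift_superset[OF p S'(1) _ S'(2)] free_lift_superset[OF q S'(1) _ S'(2)] by simp
    finally show ?thesis .
  qed
qed

lemma free_lift_gen:
  assumes "x \<in> X" shows "free_lift R P b (free_gen R x) = b x"
proof -
  have bx: "b x \<in> carrier P"
    using assms b by auto
  have "free_lift R P b (free_gen R x) = (\<Oplus>\<^bsub>P\<^esub>z\<in>{x}. free_gen R x z \<odot>\<^bsub>P\<^esub> b z)"
    using assms by (intro free_lift_superset free_gen_closed module_cring[OF P]) (auto simp: free_gen_def)
  also have "\<dots> = b x"
    using bx by (subst P.M.finsum_insert) auto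
  finally show ?thesis .
qed

end


section \<open>Quotient modules\<close>

text \<open>The record of \<open>tensor_product\<close> for an arbitrary module and submodule, so
  that well-definedness on cosets is settled before bilinear relations enter.\<close>

definition quotient_module :: "('k, 'a, 'p) module_scheme \<Rightarrow> 'a set \<Rightarrow> ('k, 'a set) module"
  where "quotient_module M H =
     \<lparr>carrier = a_rcosets\<^bsub>M\<^esub> H, mult = undefined, one = undefined, zero = H,
      add = (\<lambda>A B. A <+>\<^bsub>M\<^esub> B),
      smult = (\<lambda>a A. \<Union>p\<in>A. H +>\<^bsub>M\<^esub> (a \<odot>\<^bsub>M\<^esub> p))\<rparr>"

context
  fixes R :: "('k, 'n) ring_scheme" and M :: "('k, 'a, 'p) module_scheme" and H
  assumes M: "module R M" and H: "submodule H R M"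
begin

interpretation M: module R M by (rule M)

lemma submodule_abelian_subgroup: "abelian_subgroup H M"
  using submodule.axioms(1)[OF H] M.M.abelian_group_axioms
  by (intro abelian_subgroupI3 additive_subgroup.intro)

interpretation H: abelian_subgroup H M by (rule submodule_abelian_subgroup)

lemma quotient_carrier: "carrier (quotient_module M H) = (\<lambda>x. H +>\<^bsub>M\<^esub> x) ` carrier M"
  by (auto simp: quotient_module_def A_RCOSETS_def')

lemma quotient_add:
  "x \<in> carrier M \<Longrightarrow> y \<in> carrier M \<Longrightarrow>
    (H +>\<^bsub>M\<^esub> x) \<oplus>\<^bsub>quotient_module M H\<^esub> (H +>\<^bsub>M\<^esub> y) = H +>\<^bsub>M\<^esub> (x \<oplus>\<^bsub>M\<^esub> y)"
  by (simp add: quotient_module_def H.a_rcos_sum)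

lemma quotient_zero: "\<zero>\<^bsub>quotient_module M H\<^esub> = H +>\<^bsub>M\<^esub> \<zero>\<^bsub>M\<^esub>"
  by (simp add: quotient_module_def H.a_subset)

text \<open>The union in the scalar multiplication runs over all representatives. Two of them differ
  by an element of \<open>H\<close>, and \<open>H\<close> is closed under scalars, so all members of
  the union are the same coset.\<close>

lemma quotient_smult:
  assumes a: "a \<in> carrier R" and x: "x \<in> carrier M"
  shows "a \<odot>\<^bsub>quotient_module M H\<^esub> (H +>\<^bsub>M\<^esub> x) = H +>\<^bsub>M\<^esub> (a \<odot>\<^bsub>M\<^esub> x)"
proof -
  have "H +>\<^bsub>M\<^esub> (a \<odot>\<^bsub>M\<^esub> p) = H +>\<^bsub>M\<^esub> (a \<odot>\<^bsub>M\<^esub> x)" if p: "p \<in> H +>\<^bsub>M\<^esub> x" for p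
  proof -
    obtain h where h: "h \<in> H" "p = h \<oplus>\<^bsub>M\<^esub> x"
      using p by (auto simp: a_r_coset_def')
    then have "a \<odot>\<^bsub>M\<^esub> p = a \<odot>\<^bsub>M\<^esub> h \<oplus>\<^bsub>M\<^esub> a \<odot>\<^bsub>M\<^esub> x"
      using a x H.a_subset by (simp add: M.smult_r_distr subsetD)
    moreover have "a \<odot>\<^bsub>M\<^esub> h \<in> H"
      using H a h(1) by (rule submodule.smult_closed)
    ultimately have "a \<odot>\<^bsub>M\<^esub> p \<in> H +>\<^bsub>M\<^esub> (a \<odot>\<^bsub>M\<^esub> x)"
      by (auto simp: a_r_coset_def')
    then show ?thesis
      by (rule M.M.a_repr_independence[OF _ M.smult_closed[OF a x] H.a_subgroup, symmetric])
  qed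
  then have "(\<Union>p\<in>H +>\<^bsub>M\<^esub> x. H +>\<^bsub>M\<^esub> (a \<odot>\<^bsub>M\<^esub> p)) = H +>\<^bsub>M\<^esub> (a \<odot>\<^bsub>M\<^esub> x)"
    using H.a_rcos_self[OF x] by blast
  then show ?thesis
    by (simp add: quotient_module_def)
qed

lemma quotient_module_module: "module R (quotient_module M H)"
proof (intro moduleI abelian_groupI)
  show "\<exists>y\<in>carrier (quotient_module M H). y \<oplus>\<^bsub>quotient_module M H\<^esub> x = \<zero>\<^bsub>quotient_module M H\<^esub>"
    if "x \<in> carrier (quotient_module M H)" for x
  proof -
    obtain u where u: "u \<in> carrier M" "x = H +>\<^bsub>M\<^esub> u"
      using \<open>x \<in> _\<close> by (auto simp: quotient_carrier)
    show ?thesis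
      using u by (intro bexI[of _ "H +>\<^bsub>M\<^esub> (\<ominus>\<^bsub>M\<^esub> u)"])
        (auto simp: quotient_add quotient_zero quotient_carrier M.M.l_neg)
  qed
  show "x \<oplus>\<^bsub>quotient_module M H\<^esub> y = y \<oplus>\<^bsub>quotient_module M H\<^esub> x"
    if "x \<in> carrier (quotient_module M H)" "y \<in> carrier (quotient_module M H)" for x y
    using that by (clarsimp simp: quotient_carrier quotient_add M.M.a_comm)
qed (auto simp: quotient_carrier quotient_add quotient_smult quotient_zero module_cring[OF M]
     M.smult_l_distr M.smult_r_distr M.smult_assoc1 M.M.a_assoc)

lemma quotient_proj_hom: "(\<lambda>x. H +>\<^bsub>M\<^esub> x) \<in> mod_hom R M (quotient_module M H)"
  by (rule mod_homI) (auto simp: quotient_carrier quotient_add quotient_smult)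

context
  fixes N :: "('k, 'c, 'q) module_scheme" and f
  assumes N: "module R N" and f: "f \<in> mod_hom R M N" and ker: "\<And>h. h \<in> H \<Longrightarrow> f h = \<zero>\<^bsub>N\<^esub>"
begin

text \<open>A map that kills \<open>H\<close> is constant on each coset, so the image of a coset is
  a singleton and \<open>the_elem\<close> picks a genuine value.\<close>

lemma quotient_descend: "x \<in> carrier M \<Longrightarrow> the_elem (f ` (H +>\<^bsub>M\<^esub> x)) = f x"
proof -
  interpret N: module R N by (rule N)
  assume x: "x \<in> carrier M"
  have "f (h \<oplus>\<^bsub>M\<^esub> x) = f x" if "h \<in> H" for h
    using that x H.a_subset mod_hom_closed[OF f x] by (subst mod_hom_add[OF f]) (auto simp: ker)
  moreover have "x \<in> H +>\<^bsub>M\<^esub> x"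
    using x by (rule H.a_rcos_self)
  ultimately have "f ` (H +>\<^bsub>M\<^esub> x) = {f x}"
    by (auto simp: a_r_coset_def')
  then show ?thesis by simp
qed

lemma quotient_descend_hom: "(\<lambda>A. the_elem (f ` A)) \<in> mod_hom R (quotient_module M H) N"
proof (rule mod_homI)
  fix A assume "A \<in> carrier (quotient_module M H)"
  then obtain x where x: "x \<in> carrier M" "A = H +>\<^bsub>M\<^esub> x"
    by (auto simp: quotient_carrier)
  show "the_elem (f ` A) \<in> carrier N"
    using x mod_hom_closed[OF f] by (simp add: quotient_descend)
  show "the_elem (f ` (a \<odot>\<^bsub>quotient_module M H\<^esub> A)) = a \<odot>\<^bsub>N\<^esub> the_elem (f ` A)"
    if "a \<in> carrier R" for a
    using x that mod_hom_smult[OF f] by (simp add: quotient_smult quotient_descend)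
  fix B assume "B \<in> carrier (quotient_module M H)"
  then obtain y where y: "y \<in> carrier M" "B = H +>\<^bsub>M\<^esub> y"
    by (auto simp: quotient_carrier)
  show "the_elem (f ` (A \<oplus>\<^bsub>quotient_module M H\<^esub> B)) = the_elem (f ` A) \<oplus>\<^bsub>N\<^esub> the_elem (f ` B)"
    using x y mod_hom_add[OF f] by (simp add: quotient_add quotient_descend)
qed

end

end


section \<open>Tensor products\<close>

definition bilinear_maps ::
  "('k, 'n) ring_scheme \<Rightarrow> ('k, 'a, 'p) module_scheme \<Rightarrow> ('k, 'b, 'q) module_scheme \<Rightarrow>
    ('k, 'c, 'r) module_scheme \<Rightarrow> ('a \<Rightarrow> 'b \<Rightarrow> 'c) set"
  where "bilinear_maps R M N P = {b.
    (\<forall>x\<in>carrier M. b x \<in> mod_hom R N P) \<and> (\<forall>y\<in>carrier N. (\<lambda>x. b x y) \<in> mod_hom R M P)}"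

lemma bilinear_mapsI:
  assumes "\<And>x. x \<in> carrier M \<Longrightarrow> b x \<in> mod_hom R N P"
    and "\<And>y. y \<in> carrier N \<Longrightarrow> (\<lambda>x. b x y) \<in> mod_hom R M P"
  shows "b \<in> bilinear_maps R M N P"
  using assms by (simp add: bilinear_maps_def)

lemma bilinear_maps_right: "b \<in> bilinear_maps R M N P \<Longrightarrow> x \<in> carrier M \<Longrightarrow> b x \<in> mod_hom R N P"
  and bilinear_maps_left:
    "b \<in> bilinear_maps R M N P \<Longrightarrow> y \<in> carrier N \<Longrightarrow> (\<lambda>x. b x y) \<in> mod_hom R M P"
  by (simp_all add: bilinear_maps_def)

lemma tensor_product_quotient:
  "tensor_product R M N =
    quotient_module (free_module R (carrier M \<times> carrier N)) (tensor_kernel R M N)"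
  by (simp add: tensor_product_def quotient_module_def Let_def)

section \<open>Universal property of the tensor product\<close>

locale two_modules = M: module R M + N: module R N
  for R :: "('k, 'n) ring_scheme" and M :: "('k, 'a, 'p) module_scheme"
    and N :: "('k, 'b, 'q) module_scheme"
begin

abbreviation pairs_module where
  "pairs_module \<equiv> free_module R (carrier M \<times> carrier N)"

sublocale F: module R pairs_module
  by (rule free_module_module[OF module_cring[OF M.module_axioms]])

lemma pair_gen_closed:
  "x \<in> carrier M \<Longrightarrow> y \<in> carrier N \<Longrightarrow> free_gen R (x, y) \<in> carrier pairs_module"
  by (simp add: free_gen_closed module_cring[OF M.module_axioms])

lemma bilinear_relations_closed: "bilinear_relations R M N \<subseteq> carrier pairs_module"
  unfolding bilinear_relations_def Let_def
  by (intro Un_least subsetI; elim CollectE exE conjE; hypsubst;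
      intro F.M.minus_closed F.M.a_closed F.smult_closed pair_gen_closed
        M.M.a_closed N.M.a_closed M.smult_closed N.smult_closed; assumption)

lemma tensor_kernel_submodule: "submodule (tensor_kernel R M N) R pairs_module"
proof -
  let ?\<H> = "{H. submodule H R pairs_module \<and> bilinear_relations R M N \<subseteq> H}"
  have mem: "carrier pairs_module \<in> ?\<H>"
    using F.carrier_is_submodule bilinear_relations_closed by blast
  have "submodule (\<Inter>?\<H>) R pairs_module"
  proof (rule F.submoduleI)
    show "\<Inter>?\<H> \<subseteq> carrier pairs_module"
      using mem by blast
    show "\<zero>\<^bsub>pairs_module\<^esub> \<in> \<Inter>?\<H>"
      using subgroup.one_closed[OF submodule.axioms(1), of _ R pairs_module] by auto
    show "\<ominus>\<^bsub>pairs_module\<^esub> a \<in> \<Inter>?\<H>" if "a \<in> \<Inter>?\<H>" for a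
      using that F.submoduleE(3) by blast
    show "a \<oplus>\<^bsub>pairs_module\<^esub> b \<in> \<Inter>?\<H>" if "a \<in> \<Inter>?\<H>" "b \<in> \<Inter>?\<H>" for a b
      using that F.submoduleE(5) by blast
    show "a \<odot>\<^bsub>pairs_module\<^esub> b \<in> \<Inter>?\<H>" if "a \<in> carrier R" "b \<in> \<Inter>?\<H>" for a b
      using that F.submoduleE(4) by blast
  qed
  then show ?thesis
    by (simp add: tensor_kernel_def)
qed

lemma bilinear_relations_tensor_kernel: "bilinear_relations R M N \<subseteq> tensor_kernel R M N"
  by (auto simp: tensor_kernel_def)

lemma tensor_product_module: "module R (tensor_product R M N)"
  unfolding tensor_product_quotient
  by (rule quotient_module_module[OF F.module_axioms tensor_kernel_submodule])

abbreviation tensor_proj where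
  "tensor_proj \<equiv> \<lambda>p. tensor_kernel R M N +>\<^bsub>pairs_module\<^esub> p"

lemma tensor_proj_hom: "tensor_proj \<in> mod_hom R pairs_module (tensor_product R M N)"
  unfolding tensor_product_quotient
  by (rule quotient_proj_hom[OF F.module_axioms tensor_kernel_submodule])

lemma tensor_carrier: "carrier (tensor_product R M N) = tensor_proj ` carrier pairs_module"
  unfolding tensor_product_quotient
  by (rule quotient_carrier[OF F.module_axioms tensor_kernel_submodule])

lemma tensor_proj_relation:
  assumes "p \<ominus>\<^bsub>pairs_module\<^esub> q \<in> bilinear_relations R M N"
    and "p \<in> carrier pairs_module" "q \<in> carrier pairs_module"
  shows "tensor_proj p = tensor_proj q"
proof (rule F.M.a_coset_add_inv1)
  show "tensor_proj (p \<oplus>\<^bsub>pairs_module\<^esub> \<ominus>\<^bsub>pairs_module\<^esub> q) = tensor_kernel R M N"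
    using assms bilinear_relations_tensor_kernel F.submoduleE(1)[OF tensor_kernel_submodule]
    by (intro F.M.a_coset_join2 submodule.axioms(1)[OF tensor_kernel_submodule])
      (auto simp: F.M.minus_eq)
  show "tensor_kernel R M N \<subseteq> carrier pairs_module"
    by (rule F.submoduleE(1)[OF tensor_kernel_submodule])
qed fact+

lemma pure_tensor_bilinear:
  "pure_tensor R M N \<in> bilinear_maps R M N (tensor_product R M N)"
proof -
  note gen = pair_gen_closed
  have rel:
    "x \<in> carrier M \<Longrightarrow> x' \<in> carrier M \<Longrightarrow> y \<in> carrier N \<Longrightarrow>
      free_gen R (x \<oplus>\<^bsub>M\<^esub> x', y) \<ominus>\<^bsub>pairs_module\<^esub> (free_gen R (x, y) \<oplus>\<^bsub>pairs_module\<^esub> free_gen R (x', y))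
        \<in> bilinear_relations R M N"
    "x \<in> carrier M \<Longrightarrow> y \<in> carrier N \<Longrightarrow> y' \<in> carrier N \<Longrightarrow>
      free_gen R (x, y \<oplus>\<^bsub>N\<^esub> y') \<ominus>\<^bsub>pairs_module\<^esub> (free_gen R (x, y) \<oplus>\<^bsub>pairs_module\<^esub> free_gen R (x, y'))
        \<in> bilinear_relations R M N"
    "a \<in> carrier R \<Longrightarrow> x \<in> carrier M \<Longrightarrow> y \<in> carrier N \<Longrightarrow>
      free_gen R (a \<odot>\<^bsub>M\<^esub> x, y) \<ominus>\<^bsub>pairs_module\<^esub> (a \<odot>\<^bsub>pairs_module\<^esub> free_gen R (x, y))
        \<in> bilinear_relations R M N"
    "a \<in> carrier R \<Longrightarrow> x \<in> carrier M \<Longrightarrow> y \<in> carrier N \<Longrightarrow>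
      free_gen R (x, a \<odot>\<^bsub>N\<^esub> y) \<ominus>\<^bsub>pairs_module\<^esub> (a \<odot>\<^bsub>pairs_module\<^esub> free_gen R (x, y))
        \<in> bilinear_relations R M N"
    for a x x' y y'
    unfolding bilinear_relations_def Let_def by blast+
  show ?thesis
  proof (intro bilinear_mapsI mod_homI)
    fix x y assume xy: "x \<in> carrier M" "y \<in> carrier N"
    then show 1: "pure_tensor R M N x y \<in> carrier (tensor_product R M N)"
      by (auto simp: pure_tensor_def tensor_carrier gen)
    show "pure_tensor R M N x y \<in> carrier (tensor_product R M N)" by (rule 1)
    {
      fix x' assume x': "x' \<in> carrier M"
      show "pure_tensor R M N (x \<oplus>\<^bsub>M\<^esub> x') y =
          pure_tensor R M N x y \<oplus>\<^bsub>tensor_product R M N\<^esub> pure_tensor R M N x' y"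
        unfolding pure_tensor_def
        by (subst tensor_proj_relation[OF rel(1)[OF xy(1) x' xy(2)]])
          (use xy x' in \<open>auto simp del: free_module_simps
            simp: gen F.M.a_closed mod_hom_add[OF tensor_proj_hom]\<close>)
    next
      fix y' assume y': "y' \<in> carrier N"
      show "pure_tensor R M N x (y \<oplus>\<^bsub>N\<^esub> y') =
          pure_tensor R M N x y \<oplus>\<^bsub>tensor_product R M N\<^esub> pure_tensor R M N x y'"
        unfolding pure_tensor_def
        by (subst tensor_proj_relation[OF rel(2)[OF xy y']])
          (use xy y' in \<open>auto simp del: free_module_simps
            simp: gen F.M.a_closed mod_hom_add[OF tensor_proj_hom]\<close>)
    next
      fix a assume a: "a \<in> carrier R"
      show "pure_tensor R M N (a \<odot>\<^bsub>M\<^esub> x) y = a \<odot>\<^bsub>tensor_product R M N\<^esub> pure_tensor R M N x y"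
        unfolding pure_tensor_def
        by (subst tensor_proj_relation[OF rel(3)[OF a xy]])
          (use xy a in \<open>auto simp del: free_module_simps
            simp: gen F.smult_closed mod_hom_smult[OF tensor_proj_hom]\<close>)
      show "pure_tensor R M N x (a \<odot>\<^bsub>N\<^esub> y) = a \<odot>\<^bsub>tensor_product R M N\<^esub> pure_tensor R M N x y"
        unfolding pure_tensor_def
        by (subst tensor_proj_relation[OF rel(4)[OF a xy]])
          (use xy a in \<open>auto simp del: free_module_simps
            simp: gen F.smult_closed mod_hom_smult[OF tensor_proj_hom]\<close>)
    }
  qed
qed

lemma pure_tensor_closed:
  "x \<in> carrier M \<Longrightarrow> y \<in> carrier N \<Longrightarrow> pure_tensor R M N x y \<in> carrier (tensor_product R M N)"
  using mod_hom_closed[OF bilinear_maps_right[OF pure_tensor_bilinear]] .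

text \<open>Pure tensors are the cosets of the free generators, so they determine linear maps. This
  is what allows later identities to be checked on pure tensors without looking into cosets.\<close>

lemma tensor_hom_eq:
  assumes "module R P" "f \<in> mod_hom R (tensor_product R M N) P" "g \<in> mod_hom R (tensor_product R M N) P"
    and "\<And>x y. x \<in> carrier M \<Longrightarrow> y \<in> carrier N \<Longrightarrow> f (pure_tensor R M N x y) = g (pure_tensor R M N x y)"
    and "t \<in> carrier (tensor_product R M N)"
  shows "f t = g t"
proof -
  obtain p where p: "p \<in> carrier pairs_module" "t = tensor_proj p"
    using assms(5) by (auto simp: tensor_carrier)
  have "f (tensor_proj p) = g (tensor_proj p)"
    by (rule free_module_hom_eq[OF module_cring[OF M.module_axioms] mod_hom_comp[OF assms(2) tensor_proj_hom]
        mod_hom_comp[OF assms(3) tensor_proj_hom] assms(1) _ p(1)])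
      (use assms(4) in \<open>auto simp: pure_tensor_def\<close>)
  then show ?thesis by (simp add: p(2))
qed

context
  fixes P :: "('k, 'c, 'r) module_scheme" and b
  assumes P: "module R P" and b: "b \<in> bilinear_maps R M N P"
begin

lemma bilinear_pairs_closed: "(\<lambda>z. b (fst z) (snd z)) \<in> carrier M \<times> carrier N \<rightarrow> carrier P"
  using mod_hom_closed[OF bilinear_maps_right[OF b]] by auto

text \<open>The kernel of the linear extension of \<open>b\<close> is a submodule, and bilinearity
  says that it contains the relations; \<open>tensor_kernel\<close> is the least such
  submodule.\<close>

lemma tensor_lift_kernel: "h \<in> tensor_kernel R M N \<Longrightarrow> free_lift R P (\<lambda>z. b (fst z) (snd z)) h = \<zero>\<^bsub>P\<^esub>"
proof -
  let ?f = "free_lift R P (\<lambda>z. b (fst z) (snd z))"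
  have f: "?f \<in> mod_hom R pairs_module P"
    by (rule free_lift_hom[OF P bilinear_pairs_closed])
  have gen: "?f (free_gen R (x, y)) = b x y" if "x \<in> carrier M" "y \<in> carrier N" for x y
    using free_lift_gen[OF P bilinear_pairs_closed, of "(x, y)"] that by simp
  let ?K = "{p \<in> carrier pairs_module. ?f p = \<zero>\<^bsub>P\<^esub>}"
  have "submodule ?K R pairs_module"
    by (rule F.mod_hom_kernel_submodule[OF P f])
  moreover have "bilinear_relations R M N \<subseteq> ?K"
  proof
    fix r assume r: "r \<in> bilinear_relations R M N"
    have eqs: "?f p = ?f q \<Longrightarrow> p \<in> carrier pairs_module \<Longrightarrow> q \<in> carrier pairs_module \<Longrightarrow>
        ?f (p \<ominus>\<^bsub>pairs_module\<^esub> q) = \<zero>\<^bsub>P\<^esub>" for p q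
      using mod_hom_diff_eq_zero_iff[OF F.module_axioms P f] by blast
    have "?f r = \<zero>\<^bsub>P\<^esub>"
      using r unfolding bilinear_relations_def Let_def
      by (auto simp del: free_module_simps intro!: eqs pair_gen_closed F.M.a_closed F.smult_closed
          simp: mod_hom_add[OF f] mod_hom_smult[OF f] pair_gen_closed gen
            mod_hom_add[OF bilinear_maps_right[OF b]] mod_hom_add[OF bilinear_maps_left[OF b]]
            mod_hom_smult[OF bilinear_maps_right[OF b]] mod_hom_smult[OF bilinear_maps_left[OF b]])
    then show "r \<in> ?K"
      using r bilinear_relations_closed by blast
  qed
  ultimately show "h \<in> tensor_kernel R M N \<Longrightarrow> ?f h = \<zero>\<^bsub>P\<^esub>"
    by (auto simp: tensor_kernel_def)
qed

lemma tensor_lift_free_lift: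
  "tensor_lift R P b = (\<lambda>A. the_elem (free_lift R P (\<lambda>z. b (fst z) (snd z)) ` A))"
  by (simp add: tensor_lift_def[abs_def] free_lift_def[abs_def])

lemma tensor_lift_hom: "tensor_lift R P b \<in> mod_hom R (tensor_product R M N) P"
  unfolding tensor_product_quotient tensor_lift_free_lift
  by (rule quotient_descend_hom[OF F.module_axioms tensor_kernel_submodule P
        free_lift_hom[OF P bilinear_pairs_closed] tensor_lift_kernel])

lemma tensor_lift_pure:
  "x \<in> carrier M \<Longrightarrow> y \<in> carrier N \<Longrightarrow> tensor_lift R P b (pure_tensor R M N x y) = b x y"
  unfolding pure_tensor_def tensor_lift_free_lift
  by (subst quotient_descend[OF F.module_axioms tensor_kernel_submodule P
        free_lift_hom[OF P bilinear_pairs_closed] tensor_lift_kernel])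
    (auto simp: pair_gen_closed free_lift_gen[OF P bilinear_pairs_closed])

end

text \<open>The associator is a lift of a lift, and the outer lift requires linearity in
  \<open>z\<close> for a fixed tensor \<open>t\<close> that need not be pure. Both sides of each
  linearity law are linear in \<open>t\<close>, which reduces it to pure tensors.\<close>

lemma tensor_lift_parametric_hom:
  assumes P: "module R P" and L: "module R L"
    and b: "\<And>z. z \<in> carrier L \<Longrightarrow> b z \<in> bilinear_maps R M N P"
    and lin: "\<And>x y. x \<in> carrier M \<Longrightarrow> y \<in> carrier N \<Longrightarrow> (\<lambda>z. b z x y) \<in> mod_hom R L P"
    and t: "t \<in> carrier (tensor_product R M N)"
  shows "(\<lambda>z. tensor_lift R P (b z) t) \<in> mod_hom R L P"
proof -
  interpret L: module R L by fact
  note hom = tensor_lift_hom[OF P b] and pure = tensor_lift_pure[OF P b]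
  show ?thesis
  proof (rule mod_homI)
    fix z assume z: "z \<in> carrier L"
    show "tensor_lift R P (b z) t \<in> carrier P"
      using mod_hom_closed[OF hom[OF z] t] .
    show "tensor_lift R P (b (z \<oplus>\<^bsub>L\<^esub> z')) t =
        tensor_lift R P (b z) t \<oplus>\<^bsub>P\<^esub> tensor_lift R P (b z') t" if z': "z' \<in> carrier L" for z'
      by (rule tensor_hom_eq[OF P hom mod_hom_sum[OF P hom hom] _ t])
        (use z z' in \<open>auto simp: pure mod_hom_add[OF lin]\<close>)
    show "tensor_lift R P (b (a \<odot>\<^bsub>L\<^esub> z)) t = a \<odot>\<^bsub>P\<^esub> tensor_lift R P (b z) t"
      if a: "a \<in> carrier R" for a
      by (rule tensor_hom_eq[OF P hom mod_hom_scale[OF P hom a] _ t])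
        (use z a in \<open>auto simp: pure mod_hom_smult[OF lin]\<close>)
  qed
qed

end

section \<open>Functoriality of the tensor product\<close>

lemma (in two_modules) tensor_map_bilinear:
  assumes "module R M'" "module R N'" and f: "f \<in> mod_hom R M M'" and g: "g \<in> mod_hom R N N'"
  shows "(\<lambda>x y. pure_tensor R M' N' (f x) (g y)) \<in> bilinear_maps R M N (tensor_product R M' N')"
proof -
  interpret T': two_modules R M' N' by (intro two_modules.intro assms)
  note b = T'.pure_tensor_bilinear
  show ?thesis
    using mod_hom_comp[OF bilinear_maps_right[OF b] g] mod_hom_comp[OF bilinear_maps_left[OF b] f]
      mod_hom_closed[OF f] mod_hom_closed[OF g]
    by (intro bilinear_mapsI) auto
qed

lemma (in two_modules) tensor_map_hom:
  assumes "module R M'" "module R N'" and f: "f \<in> mod_hom R M M'" and g: "g \<in> mod_hom R N N'"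
  shows "tensor_map R M' N' f g \<in> mod_hom R (tensor_product R M N) (tensor_product R M' N')"
proof -
  interpret T': two_modules R M' N' by (intro two_modules.intro assms)
  show ?thesis
    unfolding tensor_map_def
    by (rule tensor_lift_hom[OF T'.tensor_product_module tensor_map_bilinear[OF assms]])
qed

lemma (in two_modules) tensor_map_pure:
  assumes "module R M'" "module R N'" and f: "f \<in> mod_hom R M M'" and g: "g \<in> mod_hom R N N'"
    and "x \<in> carrier M" "y \<in> carrier N"
  shows "tensor_map R M' N' f g (pure_tensor R M N x y) = pure_tensor R M' N' (f x) (g y)"
proof -
  interpret T': two_modules R M' N' by (intro two_modules.intro assms)
  show ?thesis
    unfolding tensor_map_def
    by (rule tensor_lift_pure[OF T'.tensor_product_module tensor_map_bilinear[OF assms(1-4)]]) fact+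
qed

lemma (in two_modules) tensor_map_comp:
  assumes mods: "module R M'" "module R N'" "module R M''" "module R N''"
    and f: "f \<in> mod_hom R M M'" and g: "g \<in> mod_hom R N N'"
    and f': "f' \<in> mod_hom R M' M''" and g': "g' \<in> mod_hom R N' N''"
    and t: "t \<in> carrier (tensor_product R M N)"
  shows "tensor_map R M'' N'' f' g' (tensor_map R M' N' f g t) =
    tensor_map R M'' N'' (\<lambda>x. f' (f x)) (\<lambda>y. g' (g y)) t"
proof -
  interpret T': two_modules R M' N' by (intro two_modules.intro mods)
  interpret T'': two_modules R M'' N'' by (intro two_modules.intro mods)
  note ff = mod_hom_comp[OF f' f] and gg = mod_hom_comp[OF g' g]
  show ?thesis
    by (rule tensor_hom_eq[OF T''.tensor_product_module
          mod_hom_comp[OF T'.tensor_map_hom[OF mods(3,4) f' g'] tensor_map_hom[OF mods(1,2) f g]]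
          tensor_map_hom[OF mods(3,4) ff gg] _ t])
      (simp add: tensor_map_pure[OF mods(1,2) f g] tensor_map_pure[OF mods(3,4) ff gg]
        T'.tensor_map_pure[OF mods(3,4) f' g'] mod_hom_closed[OF f] mod_hom_closed[OF g])
qed

text \<open>Elements of \<open>Bij\<close> are \<open>undefined\<close> outside the carrier, so
  linear maps get modified there; \<open>f \<otimes> g\<close> must be seen to depend only on values
  on the carriers.\<close>

lemma (in two_modules) tensor_map_cong:
  assumes mods: "module R M'" "module R N'"
    and f: "f \<in> mod_hom R M M'" and g: "g \<in> mod_hom R N N'"
    and eq: "\<And>x. x \<in> carrier M \<Longrightarrow> f' x = f x" "\<And>y. y \<in> carrier N \<Longrightarrow> g' y = g y"
    and t: "t \<in> carrier (tensor_product R M N)"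
  shows "tensor_map R M' N' f' g' t = tensor_map R M' N' f g t"
proof -
  interpret T': two_modules R M' N' by (intro two_modules.intro mods)
  have f': "f' \<in> mod_hom R M M'" and g': "g' \<in> mod_hom R N N'"
    using mod_hom_cong[OF f _ M.module_axioms] mod_hom_cong[OF g _ N.module_axioms] eq by auto
  show ?thesis
    by (rule tensor_hom_eq[OF T'.tensor_product_module tensor_map_hom[OF mods f' g']
          tensor_map_hom[OF mods f g] _ t])
      (simp add: tensor_map_pure[OF mods f g] tensor_map_pure[OF mods f' g'] eq)
qed

lemma (in two_modules) tensor_map_id:
  assumes t: "t \<in> carrier (tensor_product R M N)"
  shows "tensor_map R M N (\<lambda>x. x) (\<lambda>y. y) t = t"
  by (rule tensor_hom_eq[OF tensor_product_module
        tensor_map_hom[OF M.module_axioms N.module_axioms mod_hom_id mod_hom_id] mod_hom_id _ t])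
    (simp add: tensor_map_pure[OF M.module_axioms N.module_axioms mod_hom_id mod_hom_id])

section \<open>The associator\<close>

context
  fixes R :: "('k, 'n) ring_scheme" and L :: "('k, 'a, 'p) module_scheme"
    and M :: "('k, 'b, 'q) module_scheme" and N :: "('k, 'c, 'r) module_scheme"
  assumes L: "module R L" and M: "module R M" and N: "module R N"
begin

interpretation LM: two_modules R L M by (intro two_modules.intro L M)
interpretation MN: two_modules R M N by (intro two_modules.intro M N)
interpretation L_MN: two_modules R L "tensor_product R M N"
  by (intro two_modules.intro L MN.tensor_product_module)
interpretation LM_N: two_modules R "tensor_product R L M" N
  by (intro two_modules.intro N LM.tensor_product_module)

lemma tensor_assoc_inner_bilinear:
  assumes z: "z \<in> carrier N"
  shows "(\<lambda>x y. pure_tensor R L (tensor_product R M N) x (pure_tensor R M N y z))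
    \<in> bilinear_maps R L M (tensor_product R L (tensor_product R M N))"
  using mod_hom_comp[OF bilinear_maps_right[OF L_MN.pure_tensor_bilinear]
      bilinear_maps_left[OF MN.pure_tensor_bilinear z]]
    bilinear_maps_left[OF L_MN.pure_tensor_bilinear MN.pure_tensor_closed[OF _ z]]
  by (intro bilinear_mapsI)

lemma tensor_assoc_outer_bilinear:
  "(\<lambda>t z. tensor_lift R (tensor_product R L (tensor_product R M N))
      (\<lambda>x y. pure_tensor R L (tensor_product R M N) x (pure_tensor R M N y z)) t)
    \<in> bilinear_maps R (tensor_product R L M) N (tensor_product R L (tensor_product R M N))"
proof (intro bilinear_mapsI)
  fix t assume t: "t \<in> carrier (tensor_product R L M)"
  show "(\<lambda>z. tensor_lift R (tensor_product R L (tensor_product R M N))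
      (\<lambda>x y. pure_tensor R L (tensor_product R M N) x (pure_tensor R M N y z)) t)
    \<in> mod_hom R N (tensor_product R L (tensor_product R M N))"
    by (rule LM.tensor_lift_parametric_hom[OF L_MN.tensor_product_module N
          tensor_assoc_inner_bilinear _ t])
      (use mod_hom_comp[OF bilinear_maps_right[OF L_MN.pure_tensor_bilinear]
          bilinear_maps_right[OF MN.pure_tensor_bilinear]] in auto)
qed (rule LM.tensor_lift_hom[OF L_MN.tensor_product_module tensor_assoc_inner_bilinear])

lemma tensor_assoc_hom:
  "tensor_assoc R L M N \<in> mod_hom R (tensor_product R (tensor_product R L M) N)
    (tensor_product R L (tensor_product R M N))"
  unfolding tensor_assoc_def Let_def
  by (rule LM_N.tensor_lift_hom[OF L_MN.tensor_product_module tensor_assoc_outer_bilinear])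

lemma tensor_assoc_pure:
  assumes "x \<in> carrier L" "y \<in> carrier M" "z \<in> carrier N"
  shows "tensor_assoc R L M N (pure_tensor R (tensor_product R L M) N (pure_tensor R L M x y) z) =
    pure_tensor R L (tensor_product R M N) x (pure_tensor R M N y z)"
  unfolding tensor_assoc_def Let_def
  using assms
  by (simp add: LM_N.tensor_lift_pure[OF L_MN.tensor_product_module tensor_assoc_outer_bilinear]
      LM.pure_tensor_closed LM.tensor_lift_pure[OF L_MN.tensor_product_module tensor_assoc_inner_bilinear])

end

section \<open>The automorphism group of a coalgebra\<close>

lemma coalg_homI:
  assumes "f \<in> mod_hom K C D"
    and "\<And>c. c \<in> carrier C \<Longrightarrow> comult D (f c) = tensor_map K D D f f (comult C c)"
    and "\<And>c. c \<in> carrier C \<Longrightarrow> counit D (f c) = counit C c"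
  shows "f \<in> coalg_hom K C D"
  using assms by (simp add: coalg_hom_def)

lemma coalg_hom_mod_hom: "f \<in> coalg_hom K C D \<Longrightarrow> f \<in> mod_hom K C D"
  and coalg_hom_comult:
    "f \<in> coalg_hom K C D \<Longrightarrow> c \<in> carrier C \<Longrightarrow> comult D (f c) = tensor_map K D D f f (comult C c)"
  and coalg_hom_counit: "f \<in> coalg_hom K C D \<Longrightarrow> c \<in> carrier C \<Longrightarrow> counit D (f c) = counit C c"
  by (simp_all add: coalg_hom_def)

lemma grouplikesD:
  "c \<in> grouplikes K C \<Longrightarrow> c \<in> carrier C"
  "c \<in> grouplikes K C \<Longrightarrow> comult C c = pure_tensor K C C c c"
  "c \<in> grouplikes K C \<Longrightarrow> counit C c = \<one>\<^bsub>K\<^esub>"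
  by (simp_all add: grouplikes_def)

context coalgebra
begin

sublocale CC: two_modules K C C
  by (intro two_modules.intro module_axioms)

lemma comult_closed: "c \<in> carrier C \<Longrightarrow> comult C c \<in> carrier (tensor_product K C C)"
  by (rule mod_hom_closed[OF comult_hom])

lemma coalg_hom_cong:
  assumes f: "f \<in> coalg_hom K C C" and eq: "\<And>c. c \<in> carrier C \<Longrightarrow> g c = f c"
  shows "g \<in> coalg_hom K C C"
proof (rule coalg_homI)
  note fm = coalg_hom_mod_hom[OF f]
  show "g \<in> mod_hom K C C"
    by (rule mod_hom_cong[OF fm _ module_axioms]) (simp add: eq)
  fix c assume c: "c \<in> carrier C"
  show "comult C (g c) = tensor_map K C C g g (comult C c)"
    using CC.tensor_map_cong[OF module_axioms module_axioms fm fm eq eq comult_closed[OF c]]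
      coalg_hom_comult[OF f c] eq[OF c] by simp
  show "counit C (g c) = counit C c"
    using eq[OF c] coalg_hom_counit[OF f c] by simp
qed

lemma coalg_hom_ident: "(\<lambda>c. c) \<in> coalg_hom K C C"
  by (rule coalg_homI) (simp_all add: mod_hom_id CC.tensor_map_id comult_closed)

lemma coalg_hom_comp:
  assumes f: "f \<in> coalg_hom K C C" and g: "g \<in> coalg_hom K C C"
  shows "(\<lambda>c. g (f c)) \<in> coalg_hom K C C"
proof (rule coalg_homI)
  note fm = coalg_hom_mod_hom[OF f] and gm = coalg_hom_mod_hom[OF g]
  show "(\<lambda>c. g (f c)) \<in> mod_hom K C C"
    by (rule mod_hom_comp[OF gm fm])
  fix c assume c: "c \<in> carrier C"
  note fc = mod_hom_closed[OF fm c]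
  show "comult C (g (f c)) = tensor_map K C C (\<lambda>c. g (f c)) (\<lambda>c. g (f c)) (comult C c)"
    by (simp add: coalg_hom_comult[OF g fc] coalg_hom_comult[OF f c] comult_closed[OF c]
        CC.tensor_map_comp[OF module_axioms module_axioms module_axioms module_axioms fm fm gm gm])
  show "counit C (g (f c)) = counit C c"
    by (simp add: coalg_hom_counit[OF g fc] coalg_hom_counit[OF f c])
qed

lemma coalg_hom_inverse:
  assumes f: "f \<in> coalg_hom K C C"
    and g: "\<And>c. c \<in> carrier C \<Longrightarrow> g c \<in> carrier C"
    and fg: "\<And>c. c \<in> carrier C \<Longrightarrow> f (g c) = c"
    and gf: "\<And>c. c \<in> carrier C \<Longrightarrow> g (f c) = c"
  shows "g \<in> coalg_hom K C C"
proof (rule coalg_homI)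
  note fm = coalg_hom_mod_hom[OF f]
  show gm: "g \<in> mod_hom K C C"
  proof (rule mod_homI)
    fix x y assume x: "x \<in> carrier C" and y: "y \<in> carrier C"
    have "g (f (g x \<oplus>\<^bsub>C\<^esub> g y)) = g x \<oplus>\<^bsub>C\<^esub> g y"
      using x y by (intro gf M.a_closed g)
    then show "g (x \<oplus>\<^bsub>C\<^esub> y) = g x \<oplus>\<^bsub>C\<^esub> g y"
      using x y by (simp add: mod_hom_add[OF fm] g fg)
  next
    fix a x assume a: "a \<in> carrier K" and x: "x \<in> carrier C"
    have "g (f (a \<odot>\<^bsub>C\<^esub> g x)) = a \<odot>\<^bsub>C\<^esub> g x"
      using a x by (intro gf smult_closed g)
    then show "g (a \<odot>\<^bsub>C\<^esub> x) = a \<odot>\<^bsub>C\<^esub> g x"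
      using a x by (simp add: mod_hom_smult[OF fm] g fg)
  qed (rule g)
  fix c assume c: "c \<in> carrier C"
  note gc = g[OF c]
  have gfm: "(\<lambda>x. g (f x)) \<in> mod_hom K C C"
    by (rule mod_hom_comp[OF gm fm])
  \<comment> \<open>Writing \<open>c\<close> as \<open>f (g c)\<close> makes
    \<open>f \<otimes> f\<close> appear under \<open>g \<otimes> g\<close>, and the composite is the
    identity because \<open>g (f x) = x\<close>.\<close>
  have "tensor_map K C C g g (comult C c) = tensor_map K C C g g (tensor_map K C C f f (comult C (g c)))"
    using coalg_hom_comult[OF f gc] fg[OF c] by simp
  also have "\<dots> = tensor_map K C C (\<lambda>x. g (f x)) (\<lambda>x. g (f x)) (comult C (g c))"
    by (rule CC.tensor_map_comp[OF module_axioms module_axioms module_axioms module_axioms fm fm gm gm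
          comult_closed[OF gc]])
  also have "\<dots> = tensor_map K C C (\<lambda>x. x) (\<lambda>x. x) (comult C (g c))"
    by (rule CC.tensor_map_cong[OF module_axioms module_axioms mod_hom_id mod_hom_id _ _
          comult_closed[OF gc]]) (simp_all add: gf)
  also have "\<dots> = comult C (g c)"
    by (rule CC.tensor_map_id[OF comult_closed[OF gc]])
  finally show "comult C (g c) = tensor_map K C C g g (comult C c)" ..
  show "counit C (g c) = counit C c"
    using coalg_hom_counit[OF f gc] fg[OF c] by simp
qed

lemma coalg_hom_grouplike:
  assumes f: "f \<in> coalg_hom K C C" and c: "c \<in> grouplikes K C"
  shows "f c \<in> grouplikes K C"
proof -
  note fm = coalg_hom_mod_hom[OF f]
  note cD = grouplikesD[OF c]
  show ?thesis
    using coalg_hom_comult[OF f cD(1)] coalg_hom_counit[OF f cD(1)] cD(2,3)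
      CC.tensor_map_pure[OF module_axioms module_axioms fm fm cD(1) cD(1)] mod_hom_closed[OF fm cD(1)]
    by (simp add: grouplikes_def)
qed

lemma coalg_Aut_carrier: "carrier (coalg_Aut K C) = coalg_hom K C C \<inter> Bij (carrier C)"
  by (simp add: coalg_Aut_def)

lemma coalg_Aut_mult:
  "f \<in> carrier (coalg_Aut K C) \<Longrightarrow> g \<in> carrier (coalg_Aut K C) \<Longrightarrow>
    f \<otimes>\<^bsub>coalg_Aut K C\<^esub> g = compose (carrier C) f g"
  by (simp add: coalg_Aut_def BijGroup_def)

lemma coalg_Aut_inv_into:
  assumes f: "f \<in> carrier (coalg_Aut K C)"
  shows "(\<lambda>c\<in>carrier C. inv_into (carrier C) f c) \<in> carrier (coalg_Aut K C)"
proof -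
  have fh: "f \<in> coalg_hom K C C" and bij: "bij_betw f (carrier C) (carrier C)" and "f \<in> Bij (carrier C)"
    using f by (auto simp: coalg_Aut_carrier Bij_def)
  moreover have "(\<lambda>c\<in>carrier C. inv_into (carrier C) f c) \<in> coalg_hom K C C"
    using bij_betwE[OF bij_betw_inv_into[OF bij]] bij mod_hom_closed[OF coalg_hom_mod_hom[OF fh]]
    by (intro coalg_hom_inverse[OF fh]) (simp_all add: bij_betw_inv_into_left bij_betw_inv_into_right)
  ultimately show ?thesis
    by (simp add: coalg_Aut_carrier restrict_inv_into_Bij)
qed

lemma coalg_Aut_subgroup: "subgroup (coalg_hom K C C \<inter> Bij (carrier C)) (BijGroup (carrier C))"
proof (rule subgroup.intro)
  show "coalg_hom K C C \<inter> Bij (carrier C) \<subseteq> carrier (BijGroup (carrier C))"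
    by (simp add: BijGroup_def)
  show "f \<otimes>\<^bsub>BijGroup (carrier C)\<^esub> g \<in> coalg_hom K C C \<inter> Bij (carrier C)"
    if f: "f \<in> coalg_hom K C C \<inter> Bij (carrier C)" and g: "g \<in> coalg_hom K C C \<inter> Bij (carrier C)" for f g
    using f g coalg_hom_cong[OF coalg_hom_comp[of g f], of "compose (carrier C) f g"]
    by (simp add: BijGroup_def compose_Bij compose_eq)
  show "\<one>\<^bsub>BijGroup (carrier C)\<^esub> \<in> coalg_hom K C C \<inter> Bij (carrier C)"
    using coalg_hom_cong[OF coalg_hom_ident, of "\<lambda>c\<in>carrier C. c"] by (simp add: BijGroup_def id_Bij)
  show "inv\<^bsub>BijGroup (carrier C)\<^esub> f \<in> coalg_hom K C C \<inter> Bij (carrier C)"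
    if f: "f \<in> coalg_hom K C C \<inter> Bij (carrier C)" for f
    using f coalg_Aut_inv_into[of f] by (simp add: inv_BijGroup coalg_Aut_carrier)
qed

lemma coalg_Aut_group: "group (coalg_Aut K C)"
  unfolding coalg_Aut_def by (rule subgroup.subgroup_is_group[OF coalg_Aut_subgroup group_BijGroup])

text \<open>That \<open>f\<close> maps grouplikes to grouplikes would give no surjectivity on an
  infinite set; the inverse is a coalgebra map as well and preserves them too.\<close>

lemma coalg_Aut_grouplikes:
  assumes f: "f \<in> carrier (coalg_Aut K C)"
  shows "bij_betw f (grouplikes K C) (grouplikes K C)"
proof -
  let ?g = "\<lambda>c\<in>carrier C. inv_into (carrier C) f c"
  have g: "?g \<in> coalg_hom K C C"
    using coalg_Aut_inv_into[OF f] by (simp add: coalg_Aut_carrier)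
  have fh: "f \<in> coalg_hom K C C" and bij: "bij_betw f (carrier C) (carrier C)"
    using f by (auto simp: coalg_Aut_carrier Bij_def)
  have inj: "inj_on f (carrier C)"
    using bij by (simp add: bij_betw_def)
  show ?thesis
  proof (rule bij_betw_byWitness[where f' = ?g])
    show "\<forall>c\<in>grouplikes K C. ?g (f c) = c"
      using mod_hom_closed[OF coalg_hom_mod_hom[OF fh]] inj by (simp add: grouplikesD(1))
    show "\<forall>c\<in>grouplikes K C. f (?g c) = c"
      using bij by (simp add: grouplikesD(1) bij_betw_inv_into_right)
    show "f ` grouplikes K C \<subseteq> grouplikes K C" "?g ` grouplikes K C \<subseteq> grouplikes K C"
      using coalg_hom_grouplike[OF fh] coalg_hom_grouplike[OF g] by blast+
  qed
qed

lemma grouplike_restriction_Bij: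
  "f \<in> carrier (coalg_Aut K C) \<Longrightarrow> grouplike_restriction K C f \<in> Bij (grouplikes K C)"
  using coalg_Aut_grouplikes[of f] by (simp add: grouplike_restriction_def Bij_def)

lemma grouplike_restriction_mult:
  assumes f: "f \<in> carrier (coalg_Aut K C)" and g: "g \<in> carrier (coalg_Aut K C)"
  shows "grouplike_restriction K C (f \<otimes>\<^bsub>coalg_Aut K C\<^esub> g) =
    grouplike_restriction K C f \<otimes>\<^bsub>BijGroup (grouplikes K C)\<^esub> grouplike_restriction K C g"
  using grouplike_restriction_Bij[OF f] grouplike_restriction_Bij[OF g]
    bij_betwE[OF coalg_Aut_grouplikes[OF g]]
  by (auto simp: coalg_Aut_mult[OF f g] BijGroup_def grouplike_restriction_def compose_def fun_eq_iff
      grouplikesD(1))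

end


section \<open>The coalgebra of a quiver\<close>

text \<open>The basis elements in \<open>U\<close> are the vertices; those in \<open>B - U\<close> are the arrows, with source \<open>s\<close>
  and target \<open>t\<close>. This is the path coalgebra truncated at paths of length one.\<close>

definition quiver_coalgebra ::
  "('k, 'n) ring_scheme \<Rightarrow> 'b set \<Rightarrow> 'b set \<Rightarrow> ('b \<Rightarrow> 'b) \<Rightarrow> ('b \<Rightarrow> 'b) \<Rightarrow> ('k, 'b \<Rightarrow> 'k) coalgebra"
  where "quiver_coalgebra K B U s t =
    (let F = free_module K B; e = free_gen K; T = tensor_product K F F in
     module.extend F
      \<lparr>comult = free_lift K T (\<lambda>x. if x \<in> U then pure_tensor K F F (e x) (e x)
          else pure_tensor K F F (e (s x)) (e x) \<oplus>\<^bsub>T\<^esub> pure_tensor K F F (e x) (e (t x))),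
       counit = free_lift K (self_module K) (\<lambda>x. if x \<in> U then \<one>\<^bsub>K\<^esub> else \<zero>\<^bsub>K\<^esub>)\<rparr>)"

lemma quiver_coalgebra_fields:
  "carrier (quiver_coalgebra K B U s t) = carrier (free_module K B)"
  "\<zero>\<^bsub>quiver_coalgebra K B U s t\<^esub> = \<zero>\<^bsub>free_module K B\<^esub>"
  "add (quiver_coalgebra K B U s t) = add (free_module K B)"
  "smult (quiver_coalgebra K B U s t) = smult (free_module K B)"
  by (simp_all add: quiver_coalgebra_def module.defs Let_def)

lemma mod_hom_fields_cong:
  assumes "carrier M' = carrier M" "add M' = add M" "smult M' = smult M"
  shows "mod_hom R M' N = mod_hom R M N"
  by (simp add: mod_hom_def assms)

lemma tensor_kernel_fields_cong:
  assumes "carrier M' = carrier M" "add M' = add M" "smult M' = smult M"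
    "carrier N' = carrier N" "add N' = add N" "smult N' = smult N"
  shows "tensor_kernel R M' N' = tensor_kernel R M N"
  by (simp add: tensor_kernel_def bilinear_relations_def assms)

text \<open>The bilinear relations see only carrier, addition and scalars. Hence the tensor square
  of the free module, over which \<open>quiver_coalgebra\<close> has to define its comultiplication,
  equals the tensor square of the coalgebra itself, in which the axioms are stated.\<close>

lemma tensor_product_fields_cong:
  assumes "carrier M' = carrier M" "add M' = add M" "smult M' = smult M"
    "carrier N' = carrier N" "add N' = add N" "smult N' = smult N"
  shows "tensor_product R M' N' = tensor_product R M N" "pure_tensor R M' N' = pure_tensor R M N"
  using assms(1,4)
  by (auto simp: tensor_product_def pure_tensor_def fun_eq_iff tensor_kernel_fields_cong[OF assms])

locale quiver = field K for K (structure) +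
  fixes B U :: "'b set" and s t :: "'b \<Rightarrow> 'b"
  assumes vertices: "U \<subseteq> B"
    and source: "x \<in> B \<Longrightarrow> x \<notin> U \<Longrightarrow> s x \<in> U"
    and target: "x \<in> B \<Longrightarrow> x \<notin> U \<Longrightarrow> t x \<in> U"
begin

abbreviation "C \<equiv> quiver_coalgebra K B U s t"
abbreviation "e \<equiv> free_gen K"
abbreviation "CC \<equiv> tensor_product K C C"
abbreviation "pure \<equiv> pure_tensor K C C"

lemma C_module: "module K C"
  by (rule module_fields_cong[OF free_module_module[OF cring_axioms]]) (rule quiver_coalgebra_fields)+

lemma K_module: "module K (self_module K)"
  by (rule self_module_module[OF cring_axioms])

sublocale C: two_modules K C C
  by (intro two_modules.intro C_module)

lemma mod_hom_C: "mod_hom K C P = mod_hom K (free_module K B) P"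
  by (rule mod_hom_fields_cong) (rule quiver_coalgebra_fields)+

lemma gen_closed [simp]: "x \<in> B \<Longrightarrow> e x \<in> carrier C"
  by (simp add: quiver_coalgebra_fields free_gen_closed[OF cring_axioms])

lemma vertex_closed [simp]: "x \<in> U \<Longrightarrow> e x \<in> carrier C"
  using vertices by auto

lemma C_value [simp]: "c \<in> carrier C \<Longrightarrow> c x \<in> carrier K"
  by (simp add: quiver_coalgebra_fields mem_free_module_iff)

lemma C_value_outside: "c \<in> carrier C \<Longrightarrow> x \<notin> B \<Longrightarrow> c x = \<zero>"
  by (simp add: quiver_coalgebra_fields mem_free_module_iff)

lemma gen_value [simp]: "e x y \<in> carrier K"
  by (simp add: free_gen_def)

lemma C_hom_eq:
  assumes "module K P" "f \<in> mod_hom K C P" "g \<in> mod_hom K C P"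
    and "\<And>x. x \<in> U \<Longrightarrow> f (e x) = g (e x)"
    and "\<And>x. x \<in> B \<Longrightarrow> x \<notin> U \<Longrightarrow> f (e x) = g (e x)"
    and "c \<in> carrier C"
  shows "f c = g c"
  using free_module_hom_eq[OF cring_axioms assms(2,3)[unfolded mod_hom_C] assms(1), of c] assms(4-6)
  by (auto simp: quiver_coalgebra_fields)

lemma CC_module: "module K CC"
  by (rule C.tensor_product_module)

lemma tensor_free:
  "tensor_product K (free_module K B) (free_module K B) = CC"
  "pure_tensor K (free_module K B) (free_module K B) = pure"
  by (rule tensor_product_fields_cong; simp add: quiver_coalgebra_fields)+

definition comult_gen where
  "comult_gen = (\<lambda>x. if x \<in> U then pure (e x) (e x) else pure (e (s x)) (e x) \<oplus>\<^bsub>CC\<^esub> pure (e x) (e (t x)))"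

lemma comult_free_lift: "comult C = free_lift K CC comult_gen"
  unfolding comult_gen_def tensor_free[symmetric]
  by (simp add: quiver_coalgebra_def module.defs Let_def)

lemma comult_gen_closed: "comult_gen \<in> B \<rightarrow> carrier CC"
proof -
  interpret CC: module K CC by (rule CC_module)
  show ?thesis
    using source target by (auto simp: comult_gen_def C.pure_tensor_closed)
qed

lemma comult_hom: "comult C \<in> mod_hom K C CC"
  unfolding comult_free_lift mod_hom_C by (rule free_lift_hom[OF CC_module comult_gen_closed])

lemma comult_vertex: "x \<in> U \<Longrightarrow> comult C (e x) = pure (e x) (e x)"
  and comult_arrow: "x \<in> B \<Longrightarrow> x \<notin> U \<Longrightarrow>
    comult C (e x) = pure (e (s x)) (e x) \<oplus>\<^bsub>CC\<^esub> pure (e x) (e (t x))"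
  using free_lift_gen[OF CC_module comult_gen_closed, of x] vertices
  by (auto simp: comult_free_lift comult_gen_def)

lemma counit_free_lift: "counit C = free_lift K (self_module K) (\<lambda>x. if x \<in> U then \<one> else \<zero>)"
  by (simp add: quiver_coalgebra_def module.defs Let_def)

lemma counit_gen_closed: "(\<lambda>x. if x \<in> U then \<one> else \<zero>) \<in> B \<rightarrow> carrier (self_module K)"
  by (simp add: self_module_def)

lemma counit_hom: "counit C \<in> mod_hom K C (self_module K)"
  unfolding counit_free_lift mod_hom_C by (rule free_lift_hom[OF K_module counit_gen_closed])

lemma counit_vertex: "x \<in> U \<Longrightarrow> counit C (e x) = \<one>"
  and counit_arrow: "x \<in> B \<Longrightarrow> x \<notin> U \<Longrightarrow> counit C (e x) = \<zero>"
  using free_lift_gen[OF K_module counit_gen_closed, of x] vertices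
  by (auto simp: counit_free_lift)

text \<open>For an arrow \<open>x\<close> from \<open>v\<close> to \<open>w\<close> both sides are
  \<open>v \<otimes> v \<otimes> x + v \<otimes> x \<otimes> w + x \<otimes> w \<otimes> w\<close>;
  for a vertex both are its third tensor power.\<close>

lemma quiver_coassoc:
  assumes c: "c \<in> carrier C"
  shows "tensor_assoc K C C C (tensor_map K CC C (comult C) (\<lambda>x. x) (comult C c)) =
    tensor_map K C CC (\<lambda>x. x) (comult C) (comult C c)"
proof -
  interpret CC: module K CC by (rule CC_module)
  interpret L: two_modules K CC C by (intro two_modules.intro C_module CC_module)
  interpret R: two_modules K C CC by (intro two_modules.intro C_module CC_module)
  note assoc = tensor_assoc_hom[OF C_module C_module C_module]
  note assoc_pure = tensor_assoc_pure[OF C_module C_module C_module]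
  note lmap = C.tensor_map_hom[OF CC_module C_module comult_hom mod_hom_id]
  note lmap_pure = C.tensor_map_pure[OF CC_module C_module comult_hom mod_hom_id]
  note rmap = C.tensor_map_hom[OF C_module CC_module mod_hom_id comult_hom]
  note rmap_pure = C.tensor_map_pure[OF C_module CC_module mod_hom_id comult_hom]
  show ?thesis
  proof (rule C_hom_eq[OF R.tensor_product_module mod_hom_comp[OF assoc mod_hom_comp[OF lmap comult_hom]]
        mod_hom_comp[OF rmap comult_hom] _ _ c])
    fix x assume "x \<in> U"
    then show "tensor_assoc K C C C (tensor_map K CC C (comult C) (\<lambda>x. x) (comult C (e x))) =
        tensor_map K C CC (\<lambda>x. x) (comult C) (comult C (e x))"
      by (simp add: comult_vertex lmap_pure rmap_pure assoc_pure)
  next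
    interpret LM: module K "tensor_product K CC C" by (rule L.tensor_product_module)
    interpret RM: module K "tensor_product K C CC" by (rule R.tensor_product_module)
    fix x assume x: "x \<in> B" "x \<notin> U"
    note st = source[OF x] target[OF x]
    note cl = gen_closed[OF x(1)] vertex_closed[OF st(1)] vertex_closed[OF st(2)]
    note pc = C.pure_tensor_closed L.pure_tensor_closed R.pure_tensor_closed
    have l: "tensor_assoc K C C C (tensor_map K CC C (comult C) (\<lambda>x. x) (comult C (e x))) =
      pure_tensor K C CC (e (s x)) (pure (e (s x)) (e x)) \<oplus>\<^bsub>tensor_product K C CC\<^esub>
       (pure_tensor K C CC (e (s x)) (pure (e x) (e (t x))) \<oplus>\<^bsub>tensor_product K C CC\<^esub>
        pure_tensor K C CC (e x) (pure (e (t x)) (e (t x))))"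
      by (simp add: comult_arrow[OF x] comult_vertex st cl pc mod_hom_add[OF lmap] lmap_pure
          mod_hom_add[OF assoc] assoc_pure mod_hom_add[OF bilinear_maps_left[OF L.pure_tensor_bilinear]]
          LM.M.a_closed)
    have r: "tensor_map K C CC (\<lambda>x. x) (comult C) (comult C (e x)) =
      (pure_tensor K C CC (e (s x)) (pure (e (s x)) (e x)) \<oplus>\<^bsub>tensor_product K C CC\<^esub>
       pure_tensor K C CC (e (s x)) (pure (e x) (e (t x)))) \<oplus>\<^bsub>tensor_product K C CC\<^esub>
        pure_tensor K C CC (e x) (pure (e (t x)) (e (t x)))"
      by (simp add: comult_arrow[OF x] comult_vertex st cl pc mod_hom_add[OF rmap] rmap_pure
          mod_hom_add[OF bilinear_maps_right[OF R.pure_tensor_bilinear]])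
    \<comment> \<open>The left side groups the last two summands, the right side the first
      two.\<close>
    show "tensor_assoc K C C C (tensor_map K CC C (comult C) (\<lambda>x. x) (comult C (e x))) =
        tensor_map K C CC (\<lambda>x. x) (comult C) (comult C (e x))"
      unfolding l r using cl by (simp add: RM.M.a_assoc pc)
  qed
qed

text \<open>On an arrow, the counit kills the summand with the arrow on the left and sends the
  source to \<open>\<one>\<close>, so that \<open>\<one> \<otimes> x\<close> remains. On the other
  side it is the target that survives.\<close>

lemma quiver_counit_left:
  assumes c: "c \<in> carrier C"
  shows "tensor_map K (self_module K) C (counit C) (\<lambda>x. x) (comult C c) = pure_tensor K (self_module K) C \<one> c"
proof -
  interpret SC: two_modules K "self_module K" C by (intro two_modules.intro C_module K_module)
  interpret T: module K "tensor_product K (self_module K) C" by (rule SC.tensor_product_module)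
  have 1: "\<one> \<in> carrier (self_module K)" and 0: "\<zero> = \<zero>\<^bsub>self_module K\<^esub>"
    by (simp_all add: self_module_def)
  have z: "y \<in> carrier C \<Longrightarrow> pure_tensor K (self_module K) C \<zero> y = \<zero>\<^bsub>tensor_product K (self_module K) C\<^esub>" for y
    unfolding 0
    by (rule mod_hom_zero[OF K_module T.module_axioms bilinear_maps_left[OF SC.pure_tensor_bilinear]])
  note map = C.tensor_map_hom[OF K_module C_module counit_hom mod_hom_id]
  note map_pure = C.tensor_map_pure[OF K_module C_module counit_hom mod_hom_id]
  show ?thesis
    by (rule C_hom_eq[OF T.module_axioms mod_hom_comp[OF map comult_hom]
          bilinear_maps_right[OF SC.pure_tensor_bilinear 1] _ _ c])
      (simp_all add: comult_vertex comult_arrow map_pure counit_vertex counit_arrow source target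
        mod_hom_add[OF map] C.pure_tensor_closed z SC.pure_tensor_closed 1)
qed

lemma quiver_counit_right:
  assumes c: "c \<in> carrier C"
  shows "tensor_map K C (self_module K) (\<lambda>x. x) (counit C) (comult C c) = pure_tensor K C (self_module K) c \<one>"
proof -
  interpret CS: two_modules K C "self_module K" by (intro two_modules.intro C_module K_module)
  interpret T: module K "tensor_product K C (self_module K)" by (rule CS.tensor_product_module)
  have 1: "\<one> \<in> carrier (self_module K)" and 0: "\<zero> = \<zero>\<^bsub>self_module K\<^esub>"
    by (simp_all add: self_module_def)
  have z: "y \<in> carrier C \<Longrightarrow> pure_tensor K C (self_module K) y \<zero> = \<zero>\<^bsub>tensor_product K C (self_module K)\<^esub>" for y
    unfolding 0
    by (rule mod_hom_zero[OF K_module T.module_axioms bilinear_maps_right[OF CS.pure_tensor_bilinear]])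
  note map = C.tensor_map_hom[OF C_module K_module mod_hom_id counit_hom]
  note map_pure = C.tensor_map_pure[OF C_module K_module mod_hom_id counit_hom]
  show ?thesis
    by (rule C_hom_eq[OF T.module_axioms mod_hom_comp[OF map comult_hom]
          bilinear_maps_left[OF CS.pure_tensor_bilinear 1] _ _ c])
      (simp_all add: comult_vertex comult_arrow map_pure counit_vertex counit_arrow source target
        mod_hom_add[OF map] C.pure_tensor_closed z CS.pure_tensor_closed 1)
qed

sublocale coalg: coalgebra K C
  by (intro coalgebra.intro C_module coalgebra_axioms.intro comult_hom counit_hom
      quiver_coassoc quiver_counit_left quiver_counit_right)

end

text \<open>Serves for the span of the vertices inside the coalgebra, where a linear map is
  determined by its values at the vertices.\<close>

lemma mod_hom_free_module_mono:
  assumes "X \<subseteq> Y" "f \<in> mod_hom R (free_module R Y) P"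
  shows "f \<in> mod_hom R (free_module R X) P"
proof -
  have "carrier (free_module R X) \<subseteq> carrier (free_module R Y)"
    using assms(1) by (fastforce simp: mem_free_module_iff)
  note cl = subsetD[OF this]
  show ?thesis
    using mod_hom_closed[OF assms(2) cl] mod_hom_add[OF assms(2) cl cl] mod_hom_smult[OF assms(2) _ cl]
    by (intro mod_homI) simp_all
qed

section \<open>Coordinates of the comultiplication; grouplike and skew primitive elements\<close>

context quiver
begin

text \<open>The coefficient of \<open>e y \<otimes> e z\<close>. Since tensors are cosets,
  coordinates are obtained as the linear functionals that bilinear forms induce.\<close>

definition coef where
  "coef y z = tensor_lift K (self_module K) (\<lambda>p q. p y \<otimes> q z)"

lemma gen_apply: "e x y = (if y = x then \<one> else \<zero>)"
  by (simp add: free_gen_def)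

lemma coef_bilinear: "(\<lambda>p q. p y \<otimes> q z) \<in> bilinear_maps K C C (self_module K)"
  by (intro bilinear_mapsI mod_homI)
    (auto simp: self_module_def quiver_coalgebra_fields mem_free_module_iff l_distr r_distr m_ac)

lemma coef_hom: "coef y z \<in> mod_hom K CC (self_module K)"
  unfolding coef_def by (rule C.tensor_lift_hom[OF K_module coef_bilinear])

lemma coef_pure: "p \<in> carrier C \<Longrightarrow> q \<in> carrier C \<Longrightarrow> coef y z (pure p q) = p y \<otimes> q z"
  unfolding coef_def by (rule C.tensor_lift_pure[OF K_module coef_bilinear])

lemma coef_add:
  "u \<in> carrier CC \<Longrightarrow> v \<in> carrier CC \<Longrightarrow> coef y z (u \<oplus>\<^bsub>CC\<^esub> v) = coef y z u \<oplus> coef y z v"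
  using mod_hom_add[OF coef_hom] by (simp add: self_module_def)

lemma value_hom: "(\<lambda>c. c y) \<in> mod_hom K C (self_module K)"
  by (rule mod_homI) (auto simp: self_module_def quiver_coalgebra_fields mem_free_module_iff)

lemma zero_hom: "(\<lambda>c. \<zero>) \<in> mod_hom K C (self_module K)"
  using mod_hom_zero_map[OF K_module] by (simp add: self_module_def)

lemmas coef_gens = comult_vertex comult_arrow source target coef_add coef_pure C.pure_tensor_closed

text \<open>Arrows contribute only tensors of one vertex and one arrow, so a tensor of two vertices
  can come only from a vertex, which contributes its own square.\<close>

lemma coef_comult_vertices:
  assumes "c \<in> carrier C" "v \<in> U" "w \<in> U"
  shows "coef v w (comult C c) = (if v = w then c v else \<zero>)"
proof -
  have hom: "(\<lambda>c. if v = w then c v else \<zero>) \<in> mod_hom K C (self_module K)"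
    using value_hom zero_hom by (cases "v = w") simp_all
  show ?thesis
    by (rule C_hom_eq[OF K_module mod_hom_comp[OF coef_hom comult_hom] hom _ _ assms(1)])
      (use assms(2,3) in \<open>auto simp: coef_gens gen_apply\<close>)
qed

text \<open>Among all generators, only \<open>e y\<close> has a comultiplication in which
  \<open>e y\<close> is a right factor, and the left factor is then the source of
  \<open>y\<close>.\<close>

lemma coef_comult_source:
  assumes "c \<in> carrier C" "y \<in> B" "y \<notin> U"
  shows "coef (s y) y (comult C c) = c y"
  by (rule C_hom_eq[OF K_module mod_hom_comp[OF coef_hom comult_hom] value_hom _ _ assms(1)])
    (use source[OF assms(2,3)] assms(3) in \<open>auto simp: coef_gens gen_apply\<close>)

lemma coef_comult_target:
  assumes "c \<in> carrier C" "y \<in> B" "y \<notin> U"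
  shows "coef y (t y) (comult C c) = c y"
  by (rule C_hom_eq[OF K_module mod_hom_comp[OF coef_hom comult_hom] value_hom _ _ assms(1)])
    (use target[OF assms(2,3)] assms(3) in \<open>auto simp: coef_gens gen_apply\<close>)

text \<open>In the comultiplication of a generator, every summand has a vertex as one of its
  factors.\<close>

lemma coef_comult_arrow:
  assumes "c \<in> carrier C" "y \<in> B" "y \<notin> U"
  shows "coef y y (comult C c) = \<zero>"
  by (rule C_hom_eq[OF K_module mod_hom_comp[OF coef_hom comult_hom] zero_hom _ _ assms(1)])
    (use assms(3) in \<open>auto simp: coef_gens gen_apply dest: source target\<close>)

text \<open>Compare coordinates in \<open>\<Delta>(c) = c \<otimes> c\<close>: arrow coefficients
  have square zero and vertex coefficients are orthogonal idempotents, which in a field leaves at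
  most one nonzero coefficient, equal to \<open>\<one>\<close>.\<close>

lemma grouplikes_quiver: "grouplikes K C = e ` U"
proof (intro equalityI subsetI)
  show "c \<in> grouplikes K C" if "c \<in> e ` U" for c
    using that by (auto simp: grouplikes_def comult_vertex counit_vertex)
next
  fix c assume "c \<in> grouplikes K C"
  then have c: "c \<in> carrier C" and comult: "comult C c = pure c c" and counit: "counit C c = \<one>"
    by (auto simp: grouplikes_def)
  have arrow: "c y = \<zero>" if "y \<notin> U" for y
  proof (cases "y \<in> B")
    case True
    have "c y \<otimes> c y = \<zero>"
      using coef_comult_arrow[OF c True that] c by (simp add: comult coef_pure)
    then show ?thesis
      using c by (simp add: integral_iff)
  qed (use c C_value_outside in auto)
  have idem: "c v \<otimes> c w = (if v = w then c v else \<zero>)" if "v \<in> U" "w \<in> U" for v w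
    using coef_comult_vertices[OF c that] c by (simp add: comult coef_pure)
  \<comment> \<open>The counit condition excludes the zero vector, which also satisfies
    \<open>\<Delta>(c) = c \<otimes> c\<close>.\<close>
  have "c \<noteq> \<zero>\<^bsub>C\<^esub>"
    using counit mod_hom_zero[OF C_module K_module counit_hom] by (auto simp: self_module_def)
  then obtain v where v: "c v \<noteq> \<zero>"
    by (auto simp: quiver_coalgebra_fields)
  then have vU: "v \<in> U"
    using arrow by blast
  have "c v \<otimes> c v = c v \<otimes> \<one>"
    using idem[OF vU vU] c by simp
  then have "c v = \<one>"
    using m_lcancel[of "c v" "c v" \<one>] v c by simp
  moreover have "c w = \<zero>" if "w \<noteq> v" for w
    using that arrow idem[OF vU, of w] \<open>c v = \<one>\<close> c by (cases "w \<in> U") auto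
  ultimately have "c = e v"
    by (auto simp: free_gen_def)
  then show "c \<in> e ` U"
    using vU by blast
qed

lemma gen_eq_iff [simp]: "e x = e y \<longleftrightarrow> x = y"
  by (rule free_gen_eq_iff) simp

text \<open>Such a \<open>p\<close> may combine all arrows from \<open>v\<close> to \<open>w\<close>
  with a multiple of \<open>e v - e w\<close>. The coordinates at \<open>s x \<otimes> x\<close> and
  \<open>x \<otimes> t x\<close> show that no other arrow occurs: in each, one summand vanishes
  because \<open>x\<close> is not a vertex.\<close>

lemma skew_primitive_arrow:
  assumes p: "p \<in> carrier C" and vw: "v \<in> U" "w \<in> U"
    and comult: "comult C p = pure (e v) p \<oplus>\<^bsub>CC\<^esub> pure p (e w)"
    and x: "x \<in> B" "x \<notin> U" and px: "p x \<noteq> \<zero>"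
  shows "s x = v" "t x = w"
proof -
  note st = source[OF x] target[OF x]
  have "e v (s x) \<otimes> p x \<oplus> p (s x) \<otimes> e w x = p x"
    using coef_comult_source[OF p x] p vw by (simp add: comult coef_add coef_pure C.pure_tensor_closed)
  then show "s x = v"
    using vw x px p by (cases "s x = v") (auto simp: gen_apply split: if_splits)
  have "e v x \<otimes> p (t x) \<oplus> p x \<otimes> e w (t x) = p x"
    using coef_comult_target[OF p x] p vw by (simp add: comult coef_add coef_pure C.pure_tensor_closed)
  then show "t x = w"
    using vw x px p by (cases "t x = w") (auto simp: gen_apply split: if_splits)
qed

text \<open>The image of an arrow is skew primitive between the images of its ends. Without an arrow
  between these it would lie in the span of the vertices, which the inverse automorphism maps into
  itself; but the inverse returns the arrow.\<close>

lemma Aut_arrow: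
  assumes f: "f \<in> carrier (coalg_Aut K C)" and x: "x \<in> B" "x \<notin> U"
    and v: "v \<in> U" "f (e (s x)) = e v" and w: "w \<in> U" "f (e (t x)) = e w"
  shows "\<exists>y\<in>B - U. s y = v \<and> t y = w"
proof (rule ccontr)
  assume no_arrow: "\<not> ?thesis"
  let ?g = "\<lambda>c\<in>carrier C. inv_into (carrier C) f c"
  have fh: "f \<in> coalg_hom K C C" and bij: "bij_betw f (carrier C) (carrier C)"
    using f by (auto simp: coalg.coalg_Aut_carrier Bij_def)
  note fm = coalg_hom_mod_hom[OF fh]
  have gA: "?g \<in> carrier (coalg_Aut K C)"
    by (rule coalg.coalg_Aut_inv_into[OF f])
  then have gm: "?g \<in> mod_hom K C C"
    by (auto simp: coalg.coalg_Aut_carrier coalg_hom_def)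
  define p where "p = f (e x)"
  have p: "p \<in> carrier C"
    unfolding p_def using x by (intro mod_hom_closed[OF fm]) simp
  note st = source[OF x] target[OF x]
  have "comult C p = tensor_map K C C f f (comult C (e x))"
    unfolding p_def using x by (intro coalg_hom_comult[OF fh]) simp
  also have "\<dots> = pure (e v) p \<oplus>\<^bsub>CC\<^esub> pure p (e w)"
    using x st v w
    by (simp add: comult_arrow mod_hom_add[OF C.tensor_map_hom[OF C_module C_module fm fm]]
        C.tensor_map_pure[OF C_module C_module fm fm] C.pure_tensor_closed p_def)
  finally have comult: "comult C p = pure (e v) p \<oplus>\<^bsub>CC\<^esub> pure p (e w)" .
  have supp: "p y = \<zero>" if "y \<notin> U" for y
    using skew_primitive_arrow[OF p v(1) w(1) comult, of y] no_arrow that C_value_outside[OF p, of y]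
    by (cases "y \<in> B") auto
  then have pU: "p \<in> carrier (free_module K U)"
    using p by (auto simp: quiver_coalgebra_fields mem_free_module_iff)
  have hom_U: "h \<in> mod_hom K (free_module K U) P" if "h \<in> mod_hom K C P" for h P
    using mod_hom_free_module_mono[OF vertices] that unfolding mod_hom_C .
  \<comment> \<open>\<open>?g\<close> sends vertices to vertices, so the coefficient at the arrow
    \<open>x\<close> is zero on the image of every vertex and, by linearity, on the image of their
    span.\<close>
  have "?g p x = \<zero>"
  proof (rule free_module_hom_eq[OF cring_axioms hom_U[OF mod_hom_comp[OF value_hom gm]] hom_U[OF zero_hom]
        K_module _ pU])
    fix u assume u: "u \<in> U"
    then have "?g (e u) \<in> grouplikes K C"
      using bij_betwE[OF coalg.coalg_Aut_grouplikes[OF gA]] by (simp add: grouplikes_quiver)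
    then obtain w' where "w' \<in> U" "?g (e u) = e w'"
      unfolding grouplikes_quiver by (rule imageE)
    then show "?g (e u) x = \<zero>"
      using x by (simp only: gen_apply) auto
  qed
  moreover have "?g p = e x"
    using bij p x by (simp add: p_def bij_betw_inv_into_left mod_hom_closed[OF fm])
  ultimately show False by simp
qed

text \<open>Number and names of parallel arrows are dropped, since an automorphism may replace an
  arrow by a combination of parallel ones.\<close>

definition adjacent :: "'b \<Rightarrow> 'b \<Rightarrow> bool"
  where "adjacent v w \<longleftrightarrow> (\<exists>x\<in>B - U. s x = v \<and> t x = w)"

lemma Aut_vertex_permutation:
  assumes f: "f \<in> carrier (coalg_Aut K C)"
  obtains \<sigma> where "bij_betw \<sigma> U U" "\<And>u. u \<in> U \<Longrightarrow> f (e u) = e (\<sigma> u)"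
    "\<And>v w. v \<in> U \<Longrightarrow> w \<in> U \<Longrightarrow> adjacent (\<sigma> v) (\<sigma> w) \<longleftrightarrow> adjacent v w"
proof
  let ?g = "\<lambda>c\<in>carrier C. inv_into (carrier C) f c"
  have gA: "?g \<in> carrier (coalg_Aut K C)"
    by (rule coalg.coalg_Aut_inv_into[OF f])
  have inj: "inj_on f (carrier C)"
    using f by (auto simp: coalg.coalg_Aut_carrier Bij_def bij_betw_def)
  define \<sigma> where "\<sigma> = (\<lambda>u. inv_into U e (f (e u)))"
  have e_bij: "bij_betw e U (grouplikes K C)"
    by (auto simp: grouplikes_quiver intro!: bij_betw_imageI inj_onI)
  have "bij_betw (inv_into U e \<circ> (f \<circ> e)) U U"
    by (rule bij_betw_trans[OF bij_betw_trans[OF e_bij coalg.coalg_Aut_grouplikes[OF f]] bij_betw_inv_into[OF e_bij]])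
  then show bij: "bij_betw \<sigma> U U"
    by (simp add: \<sigma>_def comp_def)
  show fe: "f (e u) = e (\<sigma> u)" if u: "u \<in> U" for u
  proof -
    have "f (e u) \<in> grouplikes K C"
      using bij_betwE[OF coalg.coalg_Aut_grouplikes[OF f]] u by (auto simp: grouplikes_quiver)
    then show ?thesis
      unfolding \<sigma>_def using e_bij by (simp add: bij_betw_inv_into_right)
  qed
  show "adjacent (\<sigma> v) (\<sigma> w) \<longleftrightarrow> adjacent v w" if vw: "v \<in> U" "w \<in> U" for v w
  proof
    note \<sigma>U = bij_betwE[OF bij, rule_format]
    show "adjacent (\<sigma> v) (\<sigma> w)" if adj: "adjacent v w"
    proof -
      obtain x where x: "x \<in> B" "x \<notin> U" "s x = v" "t x = w"
        using adj by (auto simp: adjacent_def)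
      show ?thesis
        unfolding adjacent_def
        by (rule Aut_arrow[OF f x(1,2) \<sigma>U[OF vw(1)] _ \<sigma>U[OF vw(2)]]) (simp_all only: x(3,4) fe vw)
    qed
    \<comment> \<open>Reflection of adjacency is preservation under the inverse automorphism, which
      sends \<open>e (\<sigma> u)\<close> back to \<open>e u\<close>.\<close>
    have ge: "?g (e (\<sigma> u)) = e u" if "u \<in> U" for u
      using inv_into_f_f[OF inj vertex_closed[OF that]] that \<sigma>U[OF that] by (simp add: fe)
    show "adjacent v w" if adj: "adjacent (\<sigma> v) (\<sigma> w)"
    proof -
      obtain x where x: "x \<in> B" "x \<notin> U" "s x = \<sigma> v" "t x = \<sigma> w"
        using adj by (auto simp: adjacent_def)
      show ?thesis
        unfolding adjacent_def
        by (rule Aut_arrow[OF gA x(1,2) vw(1) _ vw(2)]) (simp_all only: x(3,4) ge vw)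
    qed
  qed
qed

end


section \<open>Group actions on a quiver\<close>

locale quiver_action = quiver K B U s t + action: group_action G B \<phi>
  for K (structure) and B U :: "'b set" and s t and G (structure) and \<phi> +
  assumes action_vertex: "g \<in> carrier G \<Longrightarrow> u \<in> U \<Longrightarrow> \<phi> g u \<in> U"
    and action_source: "g \<in> carrier G \<Longrightarrow> x \<in> B \<Longrightarrow> x \<notin> U \<Longrightarrow> s (\<phi> g x) = \<phi> g (s x)"
    and action_target: "g \<in> carrier G \<Longrightarrow> x \<in> B \<Longrightarrow> x \<notin> U \<Longrightarrow> t (\<phi> g x) = \<phi> g (t x)"
begin

lemma G_group: "group G"
  using action.group_hom by (rule group_hom.axioms(1))

lemma action_closed: "g \<in> carrier G \<Longrightarrow> x \<in> B \<Longrightarrow> \<phi> g x \<in> B"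
  using action.surj_prop by blast

lemma action_mult: "g \<in> carrier G \<Longrightarrow> h \<in> carrier G \<Longrightarrow> x \<in> B \<Longrightarrow> \<phi> (g \<otimes>\<^bsub>G\<^esub> h) x = \<phi> g (\<phi> h x)"
  by (rule action.composition_rule)

lemma action_one: "x \<in> B \<Longrightarrow> \<phi> \<one>\<^bsub>G\<^esub> x = x"
  using fun_cong[OF action.id_eq_one, of x] by simp

lemma action_inv: "g \<in> carrier G \<Longrightarrow> x \<in> B \<Longrightarrow> \<phi> (inv\<^bsub>G\<^esub> g) (\<phi> g x) = x"
  using action_mult[of "inv\<^bsub>G\<^esub> g" g x] G_group
  by (simp add: group.inv_closed group.l_inv action_one)

text \<open>Otherwise the inverse group element would carry a vertex to an arrow.\<close>

lemma action_arrow: "g \<in> carrier G \<Longrightarrow> x \<in> B \<Longrightarrow> x \<notin> U \<Longrightarrow> \<phi> g x \<notin> U"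
  using action_vertex[of "inv\<^bsub>G\<^esub> g" "\<phi> g x"] action_inv[of g x] G_group
  by (auto simp: group.inv_closed)

definition lin where "lin g = free_lift K C (\<lambda>x. e (\<phi> g x))"

lemma lin_hom: "g \<in> carrier G \<Longrightarrow> lin g \<in> mod_hom K C C"
  unfolding lin_def mod_hom_C
  by (rule free_lift_hom[OF C_module]) (simp add: action_closed)

lemma lin_gen: "g \<in> carrier G \<Longrightarrow> x \<in> B \<Longrightarrow> lin g (e x) = e (\<phi> g x)"
  unfolding lin_def by (rule free_lift_gen[OF C_module]) (simp_all add: action_closed)

lemma lin_vertex: "g \<in> carrier G \<Longrightarrow> u \<in> U \<Longrightarrow> lin g (e u) = e (\<phi> g u)"
  using vertices by (auto simp: lin_gen)

lemma lin_closed: "g \<in> carrier G \<Longrightarrow> c \<in> carrier C \<Longrightarrow> lin g c \<in> carrier C"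
  by (rule mod_hom_closed[OF lin_hom])

lemma lin_mult:
  assumes "g \<in> carrier G" "h \<in> carrier G" "c \<in> carrier C"
  shows "lin (g \<otimes>\<^bsub>G\<^esub> h) c = lin g (lin h c)"
proof -
  have hB: "\<phi> h x \<in> B" "x \<in> B" if "x \<in> U" for x
    using that vertices action_vertex[OF assms(2)] by auto
  have gh: "g \<otimes>\<^bsub>G\<^esub> h \<in> carrier G"
    using assms G_group by (simp add: group.is_monoid monoid.m_closed)
  show ?thesis
    by (rule C_hom_eq[OF C_module lin_hom[OF gh] mod_hom_comp[OF lin_hom lin_hom] _ _ assms(3)])
      (simp_all add: assms gh hB lin_gen action_mult action_closed)
qed

lemma lin_one: "c \<in> carrier C \<Longrightarrow> lin \<one>\<^bsub>G\<^esub> c = c"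
proof (rule C_hom_eq[OF C_module lin_hom mod_hom_id])
  show one: "\<one>\<^bsub>G\<^esub> \<in> carrier G"
    using G_group by (simp add: group.is_monoid monoid.one_closed)
  then show "lin \<one>\<^bsub>G\<^esub> (e x) = e x" if "x \<in> B" for x
    using that by (simp add: lin_gen action_one)
  then show "lin \<one>\<^bsub>G\<^esub> (e x) = e x" if "x \<in> U" for x
    using that vertices by blast
qed

lemma lin_inv:
  assumes "g \<in> carrier G" "c \<in> carrier C"
  shows "lin (inv\<^bsub>G\<^esub> g) (lin g c) = c" "lin g (lin (inv\<^bsub>G\<^esub> g) c) = c"
  using assms G_group lin_mult[of "inv\<^bsub>G\<^esub> g" g c] lin_mult[of g "inv\<^bsub>G\<^esub> g" c] lin_one[of c]
  by (simp_all add: group.inv_closed group.l_inv group.r_inv)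

lemma lin_coalg_hom:
  assumes g: "g \<in> carrier G"
  shows "lin g \<in> coalg_hom K C C"
proof (rule coalg_homI[OF lin_hom[OF g]])
  note gm = lin_hom[OF g]
  note map = C.tensor_map_hom[OF C_module C_module gm gm]
  note map_pure = C.tensor_map_pure[OF C_module C_module gm gm]
  fix c assume c: "c \<in> carrier C"
  show "comult C (lin g c) = tensor_map K C C (lin g) (lin g) (comult C c)"
    by (rule C_hom_eq[OF CC_module mod_hom_comp[OF comult_hom gm] mod_hom_comp[OF map comult_hom] _ _ c])
      (simp_all add: g lin_gen lin_vertex comult_vertex comult_arrow action_vertex action_arrow
        action_closed action_source action_target source target map_pure mod_hom_add[OF map]
        C.pure_tensor_closed)
  show "counit C (lin g c) = counit C c"
    by (rule C_hom_eq[OF K_module mod_hom_comp[OF counit_hom gm] counit_hom _ _ c])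
      (simp_all add: g lin_gen lin_vertex counit_vertex counit_arrow action_vertex action_arrow action_closed)
qed

text \<open>The restriction makes the map extensional, as membership in \<open>Bij\<close>
  demands.\<close>

definition \<alpha> where "\<alpha> g = restrict (lin g) (carrier C)"

lemma \<alpha>_Aut: "g \<in> carrier G \<Longrightarrow> \<alpha> g \<in> carrier (coalg_Aut K C)"
proof -
  assume g: "g \<in> carrier G"
  have "bij_betw (lin g) (carrier C) (carrier C)"
    using g G_group
    by (intro bij_betw_byWitness[where f' = "lin (inv\<^bsub>G\<^esub> g)"])
      (auto simp: lin_inv lin_closed group.inv_closed)
  then show ?thesis
    using coalg.coalg_hom_cong[OF lin_coalg_hom[OF g], of "\<alpha> g"]
    by (simp add: \<alpha>_def coalg.coalg_Aut_carrier Bij_def)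
qed

lemma \<alpha>_hom: "\<alpha> \<in> hom G (coalg_Aut K C)"
proof (rule homI)
  show "\<alpha> (g \<otimes>\<^bsub>G\<^esub> h) = \<alpha> g \<otimes>\<^bsub>coalg_Aut K C\<^esub> \<alpha> h" if gh: "g \<in> carrier G" "h \<in> carrier G" for g h
    unfolding coalg.coalg_Aut_mult[OF \<alpha>_Aut[OF gh(1)] \<alpha>_Aut[OF gh(2)]]
    using gh by (auto simp: \<alpha>_def compose_def lin_mult lin_closed)
qed (rule \<alpha>_Aut)

lemma \<alpha>_vertex: "g \<in> carrier G \<Longrightarrow> u \<in> U \<Longrightarrow> \<alpha> g (e u) = e (\<phi> g u)"
  by (simp add: \<alpha>_def lin_vertex)

lemma G_coalgebra_quiver: "G_coalgebra G K C \<alpha>"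
  by (intro G_coalgebra.intro coalg.coalgebra_axioms group_hom.intro G_group coalg.coalg_Aut_group
      group_hom_axioms.intro \<alpha>_hom)

end

text \<open>What a graph must provide for the theorem, with \<open>W\<close> as the copy of
  \<open>V\<close>. Faithfulness is tested outside \<open>W\<close> because the action on the
  remaining grouplikes has to be faithful by itself.\<close>

locale rigid_quiver_action = quiver_action +
  fixes W
  assumes W_vertices: "W \<subseteq> U"
    and W_invariant: "g \<in> carrier G \<Longrightarrow> w \<in> W \<Longrightarrow> \<phi> g w \<in> W"
    and faithful: "g \<in> carrier G \<Longrightarrow> h \<in> carrier G \<Longrightarrow> (\<And>u. u \<in> U - W \<Longrightarrow> \<phi> g u = \<phi> h u) \<Longrightarrow> g = h"
    and rigid: "bij_betw \<sigma> U U \<Longrightarrow>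
      (\<And>v w. v \<in> U \<Longrightarrow> w \<in> U \<Longrightarrow> adjacent (\<sigma> v) (\<sigma> w) \<longleftrightarrow> adjacent v w) \<Longrightarrow>
      \<exists>g\<in>carrier G. \<forall>u\<in>U. \<sigma> u = \<phi> g u"
begin

lemma inv_carrier: "g \<in> carrier G \<Longrightarrow> inv\<^bsub>G\<^esub> g \<in> carrier G"
  using G_group by (rule group.inv_closed)

lemma Aut_vertices:
  assumes "f \<in> carrier (coalg_Aut K C)"
  obtains g where "g \<in> carrier G" "\<And>u. u \<in> U \<Longrightarrow> f (e u) = e (\<phi> g u)"
proof -
  obtain \<sigma> where \<sigma>: "bij_betw \<sigma> U U" "\<And>u. u \<in> U \<Longrightarrow> f (e u) = e (\<sigma> u)"
    "\<And>v w. v \<in> U \<Longrightarrow> w \<in> U \<Longrightarrow> adjacent (\<sigma> v) (\<sigma> w) \<longleftrightarrow> adjacent v w"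
    using Aut_vertex_permutation[OF assms] by metis
  then show thesis
    using rigid[OF \<sigma>(1,3)] that by metis
qed

lemma action_inv': "g \<in> carrier G \<Longrightarrow> x \<in> B \<Longrightarrow> \<phi> g (\<phi> (inv\<^bsub>G\<^esub> g) x) = x"
  using action_mult[of g "inv\<^bsub>G\<^esub> g" x] inv_carrier[of g] G_group
  by (simp add: group.r_inv action_one)

lemma \<alpha>_Bij_vertices:
  assumes D: "D \<subseteq> U" and inv: "\<And>g u. g \<in> carrier G \<Longrightarrow> u \<in> D \<Longrightarrow> \<phi> g u \<in> D"
    and g: "g \<in> carrier G"
  shows "bij_betw (\<alpha> g) (e ` D) (e ` D)"
proof (rule bij_betw_byWitness[where f' = "\<alpha> (inv\<^bsub>G\<^esub> g)"])
  have DB: "u \<in> U" "u \<in> B" if "u \<in> D" for u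
    using that D vertices by auto
  have DU: "\<phi> h u \<in> U" if "u \<in> D" "h \<in> carrier G" for h u
    using inv[OF that(2,1)] D by auto
  show "\<forall>a\<in>e ` D. \<alpha> (inv\<^bsub>G\<^esub> g) (\<alpha> g a) = a" "\<forall>a\<in>e ` D. \<alpha> g (\<alpha> (inv\<^bsub>G\<^esub> g) a) = a"
    by (auto simp: \<alpha>_vertex g inv_carrier DU DB action_inv action_inv')
  show "\<alpha> g ` e ` D \<subseteq> e ` D" "\<alpha> (inv\<^bsub>G\<^esub> g) ` e ` D \<subseteq> e ` D"
    by (auto simp: \<alpha>_vertex g inv_carrier DB inv)
qed

lemma \<alpha>_restrict_action:
  assumes D: "D \<subseteq> U" and inv: "\<And>g u. g \<in> carrier G \<Longrightarrow> u \<in> D \<Longrightarrow> \<phi> g u \<in> D"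
  shows "group_action G (e ` D) (\<lambda>g. restrict (\<alpha> g) (e ` D))"
proof (intro group_action.intro group_hom.intro group_hom_axioms.intro G_group group_BijGroup homI)
  fix g assume g: "g \<in> carrier G"
  show Bij: "restrict (\<alpha> g) (e ` D) \<in> carrier (BijGroup (e ` D))" if "g \<in> carrier G" for g
    using \<alpha>_Bij_vertices[OF D inv that] by (simp add: BijGroup_def Bij_def)
  fix h assume h: "h \<in> carrier G"
  have DB: "u \<in> U" "u \<in> B" if "u \<in> D" for u
    using that D vertices by auto
  have "\<alpha> (g \<otimes>\<^bsub>G\<^esub> h) (e u) = \<alpha> g (\<alpha> h (e u)) \<and> \<alpha> h (e u) \<in> e ` D" if "u \<in> D" for u
    using that g h inv[of h u] G_group D
    by (simp add: \<alpha>_vertex DB action_mult action_vertex group.is_monoid monoid.m_closed)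
  then show "restrict (\<alpha> (g \<otimes>\<^bsub>G\<^esub> h)) (e ` D) =
      restrict (\<alpha> g) (e ` D) \<otimes>\<^bsub>BijGroup (e ` D)\<^esub> restrict (\<alpha> h) (e ` D)"
    using Bij[OF g] Bij[OF h] by (auto simp: BijGroup_def compose_def fun_eq_iff)
qed

lemma \<alpha>_eq_on_vertices:
  assumes "g \<in> carrier G" "h \<in> carrier G" "\<And>u. u \<in> U - W \<Longrightarrow> \<alpha> g (e u) = \<alpha> h (e u)"
  shows "g = h"
  using assms by (intro faithful) (auto simp: \<alpha>_vertex)

lemma \<alpha>_mon: "\<alpha> \<in> mon G (coalg_Aut K C)"
  using \<alpha>_hom by (auto simp: mon_def intro!: inj_onI \<alpha>_eq_on_vertices)

text \<open>Injectivity is already visible on the vertices. The image is exhausted because every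
  automorphism agrees on the vertices with some \<open>\<alpha> g\<close>, although the two may
  differ on arrows.\<close>

lemma restriction_iso:
  "grouplike_restriction K C \<circ> \<alpha> \<in>
    iso G (BijGroup (grouplikes K C)
      \<lparr>carrier := grouplike_restriction K C ` carrier (coalg_Aut K C)\<rparr>)"
proof (rule isoI)
  let ?r = "grouplike_restriction K C"
  show "?r \<circ> \<alpha> \<in> hom G (BijGroup (grouplikes K C) \<lparr>carrier := ?r ` carrier (coalg_Aut K C)\<rparr>)"
    using \<alpha>_hom by (intro homI) (simp_all add: hom_mult[OF \<alpha>_hom] \<alpha>_Aut coalg.grouplike_restriction_mult)
  have "inj_on (?r \<circ> \<alpha>) (carrier G)"
  proof (rule inj_onI)
    fix g h assume g: "g \<in> carrier G" and h: "h \<in> carrier G" and eq: "(?r \<circ> \<alpha>) g = (?r \<circ> \<alpha>) h"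
    have "\<alpha> g (e u) = \<alpha> h (e u)" if "u \<in> U" for u
      using fun_cong[OF eq, of "e u"] that by (simp add: grouplike_restriction_def grouplikes_quiver)
    then show "g = h"
      by (intro \<alpha>_eq_on_vertices[OF g h]) simp
  qed
  moreover have "?r f \<in> (?r \<circ> \<alpha>) ` carrier G" if f: "f \<in> carrier (coalg_Aut K C)" for f
  proof -
    obtain g where g: "g \<in> carrier G" "\<And>u. u \<in> U \<Longrightarrow> f (e u) = e (\<phi> g u)"
      using Aut_vertices[OF f] by metis
    then have "?r f = (?r \<circ> \<alpha>) g"
      by (auto simp: grouplike_restriction_def grouplikes_quiver \<alpha>_vertex fun_eq_iff restrict_def)
    then show ?thesis using g(1) by (rule image_eqI)
  qed
  ultimately show "bij_betw (?r \<circ> \<alpha>) (carrier G)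
      (carrier (BijGroup (grouplikes K C) \<lparr>carrier := ?r ` carrier (coalg_Aut K C)\<rparr>))"
    using \<alpha>_Aut by (auto simp: bij_betw_def)
qed

lemma Aut_W:
  assumes f: "f \<in> carrier (coalg_Aut K C)"
  shows "f ` e ` W = e ` W"
proof -
  obtain g where g: "g \<in> carrier G" "\<And>u. u \<in> U \<Longrightarrow> f (e u) = e (\<phi> g u)"
    using Aut_vertices[OF f] by metis
  have "f ` e ` W = \<alpha> g ` e ` W"
    unfolding image_image using g W_vertices by (intro image_cong) (auto simp: \<alpha>_vertex)
  also have "\<dots> = e ` W"
    using \<alpha>_Bij_vertices[OF W_vertices W_invariant g(1)] by (simp add: bij_betw_def)
  finally show ?thesis .
qed

lemma complement_faithful_action:
  "faithful_action G (e ` (U - W)) (\<lambda>g. restrict (\<alpha> g) (e ` (U - W)))"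
proof (intro faithful_action.intro faithful_action_axioms.intro)
  show "group_action G (e ` (U - W)) (\<lambda>g. restrict (\<alpha> g) (e ` (U - W)))"
  proof (rule \<alpha>_restrict_action)
    fix g u assume g: "g \<in> carrier G" and u: "u \<in> U - W"
    then have "u \<in> B"
      using vertices by auto
    \<comment> \<open>If \<open>\<phi> g u\<close> were in \<open>W\<close>, the inverse of
      \<open>g\<close> would bring \<open>u\<close> into \<open>W\<close>.\<close>
    then show "\<phi> g u \<in> U - W"
      using u g W_invariant[OF inv_carrier[OF g], of "\<phi> g u"] by (auto simp: action_vertex action_inv)
  qed auto
  show "inj_on (\<lambda>g. restrict (\<alpha> g) (e ` (U - W))) (carrier G)"
  proof (rule inj_onI)
    fix g h assume g: "g \<in> carrier G" and h: "h \<in> carrier G"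
      and eq: "restrict (\<alpha> g) (e ` (U - W)) = restrict (\<alpha> h) (e ` (U - W))"
    show "g = h"
    proof (rule \<alpha>_eq_on_vertices[OF g h])
      show "\<alpha> g (e u) = \<alpha> h (e u)" if "u \<in> U - W" for u
        using fun_cong[OF eq, of "e u"] imageI[OF that, of e] by simp
    qed
  qed
qed

lemma complement_grouplikes: "grouplikes K C - e ` W = e ` (U - W)"
  by (auto simp: grouplikes_quiver)

lemma realization:
  assumes j: "inj_on j V" "j ` V = W" and \<rho>: "\<And>g v. g \<in> carrier G \<Longrightarrow> v \<in> V \<Longrightarrow> \<rho> g v \<in> V"
    and equivariant: "\<And>g v. g \<in> carrier G \<Longrightarrow> v \<in> V \<Longrightarrow> \<phi> g (j v) = j (\<rho> g v)"
  shows "\<exists>\<iota>. inj_on \<iota> V \<and> \<iota> ` V \<subseteq> grouplikes K C \<and>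
      (\<forall>f\<in>carrier (coalg_Aut K C). f ` (\<iota> ` V) = \<iota> ` V) \<and>
      (\<forall>g\<in>carrier G. transport_action \<iota> V \<rho> g = restrict (\<alpha> g) (\<iota> ` V)) \<and>
      (\<exists>\<rho>'. faithful_action G (grouplikes K C - \<iota> ` V) \<rho>' \<and>
        (\<forall>g\<in>carrier G. grouplike_restriction K C (\<alpha> g) =
          sum_action (\<iota> ` V) (transport_action \<iota> V \<rho>) (grouplikes K C - \<iota> ` V) \<rho>' g))"
proof (intro exI conjI ballI)
  let ?\<iota> = "\<lambda>v. e (j v)"
  have image: "?\<iota> ` V = e ` W"
    by (simp add: j(2)[symmetric] image_image)
  have jU: "j v \<in> U" if "v \<in> V" for v
    using that j(2) W_vertices by auto
  show inj: "inj_on ?\<iota> V"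
    using j(1) by (auto simp: inj_on_def)
  show "?\<iota> ` V \<subseteq> grouplikes K C"
    using W_vertices by (auto simp: image grouplikes_quiver)
  show "f ` (?\<iota> ` V) = ?\<iota> ` V" if "f \<in> carrier (coalg_Aut K C)" for f
    unfolding image by (rule Aut_W[OF that])
  show transport: "transport_action ?\<iota> V \<rho> g = restrict (\<alpha> g) (?\<iota> ` V)" if g: "g \<in> carrier G" for g
  proof -
    have "?\<iota> (\<rho> g (inv_into V ?\<iota> (?\<iota> v))) = \<alpha> g (?\<iota> v)" if "v \<in> V" for v
      using inv_into_f_f[OF inj that] that g by (simp add: \<alpha>_vertex jU equivariant)
    then show ?thesis
      unfolding transport_action_def by (intro restrict_ext) auto
  qed
  show "faithful_action G (grouplikes K C - ?\<iota> ` V) (\<lambda>g. restrict (\<alpha> g) (e ` (U - W)))"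
    unfolding image complement_grouplikes by (rule complement_faithful_action)
  fix g assume g: "g \<in> carrier G"
  have "grouplikes K C = e ` W \<union> e ` (U - W)"
    using W_vertices by (auto simp: grouplikes_quiver)
  then show "grouplike_restriction K C (\<alpha> g) =
      sum_action (?\<iota> ` V) (transport_action ?\<iota> V \<rho>) (grouplikes K C - ?\<iota> ` V)
        (\<lambda>g. restrict (\<alpha> g) (e ` (U - W))) g"
    unfolding sum_action_def transport[OF g] unfolding image complement_grouplikes grouplike_restriction_def
    by (auto simp: fun_eq_iff restrict_def)
qed

end

section \<open>A quiver realizing a permutation representation\<close>

text \<open>Consider a least moved point \<open>c\<close>. If \<open>\<kappa> c\<close> is below
  \<open>c\<close>, it is fixed by minimality, against injectivity. If it is above, surjectivity
  enters: the shift of the natural numbers is increasing and moves every point.\<close>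

lemma well_order_automorphism_trivial:
  assumes r: "well_order_on X r" and bij: "bij_betw \<kappa> X X"
    and mono: "\<And>c d. c \<in> X \<Longrightarrow> d \<in> X \<Longrightarrow> (c, d) \<in> r - Id \<Longrightarrow> (\<kappa> c, \<kappa> d) \<in> r - Id"
    and c: "c \<in> X"
  shows "\<kappa> c = c"
proof -
  have wf: "wf (r - Id)" and total: "total_on X r" and antisym: "antisym r"
    using r by (auto simp: well_order_on_def linear_order_on_def partial_order_on_def)
  have cl: "d \<in> X \<Longrightarrow> \<kappa> d \<in> X" for d
    using bij by (auto simp: bij_betw_def)
  show ?thesis
    using wf c
  proof (induction c rule: wf_induct_rule)
    case (less c)
    show ?case
    proof (rule ccontr)
      assume ne: "\<kappa> c \<noteq> c"
      then consider "(\<kappa> c, c) \<in> r - Id" | "(c, \<kappa> c) \<in> r - Id"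
        using total cl[OF less.prems] less.prems by (auto simp: total_on_def)
      then show False
      proof cases
        case 1
        then have "\<kappa> (\<kappa> c) = \<kappa> c"
          using less.IH cl[OF less.prems] by blast
        then show False
          using ne bij less.prems cl[OF less.prems] by (auto simp: bij_betw_def inj_on_def)
      next
        case 2
        \<comment> \<open>The preimage \<open>d\<close> of \<open>c\<close> is not below
          \<open>c\<close>, where points are fixed, nor above it, since monotonicity would put
          \<open>\<kappa> c\<close> below \<open>\<kappa> d = c\<close>.\<close>
        obtain d where d: "d \<in> X" "c = \<kappa> d"
          using bij less.prems by (auto simp: bij_betw_def)
        then have "d \<noteq> c"
          using ne by auto
        then consider "(d, c) \<in> r - Id" | "(c, d) \<in> r - Id"
          using total d(1) less.prems by (auto simp: total_on_def)
        then show False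
        proof cases
          case 1
          then show False using less.IH[OF _ d(1)] d(2) ne by auto
        next
          case b: 2
          then have "(\<kappa> c, c) \<in> r - Id"
            using mono[OF less.prems d(1)] d(2) by simp
          then show False using 2 antisym by (auto simp: antisym_def)
        qed
      qed
    qed
  qed
qed

text \<open>The vertices are \<open>[c]\<close> and \<open>[x, c]\<close> for \<open>x \<in> G\<close> and \<open>c\<close> in the disjoint union \<open>X\<close> of \<open>G\<close> and
  \<open>V\<close>. There are arrows from \<open>[x, c]\<close> to \<open>[x, d]\<close> for \<open>c < d\<close> in a well-order of \<open>X\<close>, and from
  \<open>[x, c]\<close> to \<open>[x \<cdot> c]\<close>. Naturals only pad the names of the arrows of the second kind.\<close>

locale permutation_quiver = rep: group_action G V \<rho> for G (structure) and V \<rho> +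
  fixes r :: "(nat + 'a + 'b) rel"
  assumes well_order: "well_order_on (Inr ` (Sum_Type.Plus (carrier G) V)) r"
begin

abbreviation X :: "(nat + 'a + 'b) set" where "X \<equiv> Inr ` (Sum_Type.Plus (carrier G) V)"

abbreviation elt :: "'a \<Rightarrow> nat + 'a + 'b" where "elt x \<equiv> Inr (Inl x)"

abbreviation pt :: "'b \<Rightarrow> nat + 'a + 'b" where "pt v \<equiv> Inr (Inr v)"

fun act :: "'a \<Rightarrow> nat + 'a + 'b \<Rightarrow> nat + 'a + 'b" where
  "act g (Inr (Inl x)) = elt (g \<otimes> x)"
| "act g (Inr (Inr v)) = pt (\<rho> g v)"
| "act g (Inl n) = Inl n"

definition U :: "(nat + 'a + 'b) list set" where
  "U = {[c] | c. c \<in> X} \<union> {[elt x, c] | x c. x \<in> carrier G \<and> c \<in> X}"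

text \<open>The length tells the four kinds of basis elements apart: vertices have length 1 or 2,
  order arrows 3, arrows to \<open>[act x c]\<close> 4. The first two entries of an arrow name its
  source, which makes \<open>take 2\<close> the source map.\<close>

definition B :: "(nat + 'a + 'b) list set" where
  "B = U \<union> {[elt x, c, d] | x c d. x \<in> carrier G \<and> c \<in> X \<and> d \<in> X \<and> (c, d) \<in> r - Id} \<union>
    {[elt x, c, Inl 0, Inl 0] | x c. x \<in> carrier G \<and> c \<in> X}"

definition tgt :: "(nat + 'a + 'b) list \<Rightarrow> (nat + 'a + 'b) list" where
  "tgt l = (if length l = 3 then [l ! 0, l ! 2] else [act (projl (projr (l ! 0))) (l ! 1)])"

text \<open>The head is a point of \<open>X\<close> in a one-element list and the index of a copy in
  all others. Positions inside a copy stay fixed, so the order arrows are respected.\<close>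

definition \<phi> :: "'a \<Rightarrow> (nat + 'a + 'b) list \<Rightarrow> (nat + 'a + 'b) list" where
  "\<phi> g = (\<lambda>l\<in>B. act g (hd l) # tl l)"

sublocale G: group G
  using rep.group_hom by (rule group_hom.axioms(1))

lemma \<rho>_closed: "g \<in> carrier G \<Longrightarrow> v \<in> V \<Longrightarrow> \<rho> g v \<in> V"
  using rep.surj_prop by blast

lemma elt_X [simp]: "elt x \<in> X \<longleftrightarrow> x \<in> carrier G"
  and pt_X [simp]: "pt v \<in> X \<longleftrightarrow> v \<in> V"
  by auto

lemma act_closed: "g \<in> carrier G \<Longrightarrow> c \<in> X \<Longrightarrow> act g c \<in> X"
  by (auto simp: \<rho>_closed)

lemma act_mult: "g \<in> carrier G \<Longrightarrow> h \<in> carrier G \<Longrightarrow> c \<in> X \<Longrightarrow> act (g \<otimes> h) c = act g (act h c)"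
  by (auto simp: G.m_assoc rep.composition_rule)

lemma act_one: "c \<in> X \<Longrightarrow> act \<one> c = c"
proof -
  have "\<rho> \<one> v = v" if "v \<in> V" for v
    using fun_cong[OF rep.id_eq_one, of v] that by simp
  then show "c \<in> X \<Longrightarrow> act \<one> c = c" by auto
qed

lemma U_cases:
  assumes "u \<in> U"
  obtains (short) c where "c \<in> X" "u = [c]"
    | (long) x c where "x \<in> carrier G" "c \<in> X" "u = [elt x, c]"
  using assms[unfolded U_def Un_iff mem_Collect_eq]
  by (elim disjE exE conjE) (rule that; assumption)+

lemma short_U [simp]: "[c] \<in> U \<longleftrightarrow> c \<in> X"
  and long_U [simp]: "[b, c] \<in> U \<longleftrightarrow> b \<in> elt ` carrier G \<and> c \<in> X"
  and other_U [simp]: "b # c # d # l \<notin> U"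
  by (auto simp: U_def)

lemma U_B: "U \<subseteq> B"
  by (auto simp: B_def)

lemma arrow_cases:
  assumes "l \<in> B" "l \<notin> U"
  obtains (order) x c d where "x \<in> carrier G" "c \<in> X" "d \<in> X" "(c, d) \<in> r - Id" "l = [elt x, c, d]"
    | (action) x c where "x \<in> carrier G" "c \<in> X" "l = [elt x, c, Inl 0, Inl 0]"
  using assms(1)[unfolded B_def Un_iff mem_Collect_eq]
proof (elim disjE exE conjE)
  assume "l \<in> U"
  with assms(2) show thesis ..
qed (rule that; assumption)+

lemma B_closed:
  assumes g: "g \<in> carrier G" and l: "l \<in> B" shows "act g (hd l) # tl l \<in> B"
proof (cases "l \<in> U")
  case True
  then have "act g (hd l) # tl l \<in> U"
    using act_closed[OF g] g by (cases rule: U_cases) (simp_all add: image_iff)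
  then show ?thesis
    using U_B by blast
next
  case False
  with l show ?thesis
  proof (cases rule: arrow_cases)
    case (order x c d)
    then show ?thesis
      unfolding B_def using g by auto
  next
    case (action x c)
    then show ?thesis
      unfolding B_def using g by auto
  qed
qed

lemma \<phi>_short: "c \<in> X \<Longrightarrow> \<phi> g [c] = [act g c]"
  and \<phi>_long: "x \<in> carrier G \<Longrightarrow> c \<in> X \<Longrightarrow> \<phi> g [elt x, c] = [elt (g \<otimes> x), c]"
  using U_B by (auto simp: \<phi>_def subset_iff)

lemma \<phi>_order: "x \<in> carrier G \<Longrightarrow> c \<in> X \<Longrightarrow> d \<in> X \<Longrightarrow> (c, d) \<in> r - Id \<Longrightarrow>
    \<phi> g [elt x, c, d] = [elt (g \<otimes> x), c, d]"
  and \<phi>_action: "x \<in> carrier G \<Longrightarrow> c \<in> X \<Longrightarrow>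
    \<phi> g [elt x, c, Inl 0, Inl 0] = [elt (g \<otimes> x), c, Inl 0, Inl 0]"
  by (auto simp: \<phi>_def B_def)

lemma hd_B: "l \<in> B \<Longrightarrow> l \<noteq> [] \<and> hd l \<in> X"
  by (cases "l \<in> U") (erule U_cases arrow_cases; simp)+

lemma \<phi>_action_on_B: "group_action G B \<phi>"
proof (intro group_action.intro group_hom.intro group_hom_axioms.intro G.is_group group_BijGroup homI)
  have mult: "\<phi> (g \<otimes> h) l = \<phi> g (\<phi> h l)" if "g \<in> carrier G" "h \<in> carrier G" "l \<in> B" for g h l
    using that hd_B[OF that(3)] B_closed by (simp add: \<phi>_def act_mult)
  have one: "\<phi> \<one> l = l" if "l \<in> B" for l
    using that hd_B[OF that] by (simp add: \<phi>_def act_one)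
  have closed: "\<phi> g l \<in> B" if "g \<in> carrier G" "l \<in> B" for g l
    using that B_closed by (simp add: \<phi>_def)
  fix g assume g: "g \<in> carrier G"
  show Bij: "\<phi> g \<in> carrier (BijGroup B)" if g: "g \<in> carrier G" for g
  proof -
    have "bij_betw (\<phi> g) B B"
      using g mult[of "inv g" g] mult[of g "inv g"]
      by (intro bij_betw_byWitness[where f' = "\<phi> (inv g)"]) (auto simp: closed one)
    then show ?thesis
      by (simp add: BijGroup_def Bij_def) (simp add: \<phi>_def)
  qed
  fix h assume h: "h \<in> carrier G"
  show "\<phi> (g \<otimes> h) = \<phi> g \<otimes>\<^bsub>BijGroup B\<^esub> \<phi> h"
  proof
    fix l show "\<phi> (g \<otimes> h) l = (\<phi> g \<otimes>\<^bsub>BijGroup B\<^esub> \<phi> h) l"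
      using Bij[OF g] Bij[OF h] mult[OF g h, of l]
      by (cases "l \<in> B") (simp_all add: BijGroup_def compose_def \<phi>_def[of "g \<otimes> h"])
  qed
qed

end

section \<open>Rigidity of the graph\<close>

locale permutation_coalgebra = permutation_quiver G V \<rho> r + field K
  for G (structure) and V \<rho> r and K (structure)
begin

sublocale Q: quiver_action K B U "take 2" tgt G \<phi>
proof (intro quiver_action.intro quiver.intro field_axioms \<phi>_action_on_B quiver_axioms.intro
    quiver_action_axioms.intro U_B)
  show "take 2 l \<in> U" if "l \<in> B" "l \<notin> U" for l
    using that by (cases rule: arrow_cases) auto
  show "tgt l \<in> U" if "l \<in> B" "l \<notin> U" for l
    using that act_closed by (cases rule: arrow_cases) (auto simp: tgt_def)
  fix g assume g: "g \<in> carrier G"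
  show "\<phi> g u \<in> U" if "u \<in> U" for u
    using that g act_closed[OF g] by (cases rule: U_cases) (auto simp: \<phi>_short \<phi>_long)
  show "take 2 (\<phi> g l) = \<phi> g (take 2 l)" if "l \<in> B" "l \<notin> U" for l
    using that by (cases rule: arrow_cases) (auto simp: \<phi>_long \<phi>_order \<phi>_action)
  show "tgt (\<phi> g l) = \<phi> g (tgt l)" if "l \<in> B" "l \<notin> U" for l
    using that g act_closed
    by (cases rule: arrow_cases)
      (simp_all add: \<phi>_long \<phi>_order \<phi>_action tgt_def \<phi>_short act_mult)
qed

lemma adjacent_cases:
  "Q.adjacent v w \<longleftrightarrow>
    (\<exists>x c d. x \<in> carrier G \<and> c \<in> X \<and> d \<in> X \<and> (c, d) \<in> r - Id \<and> v = [elt x, c] \<and> w = [elt x, d]) \<or>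
    (\<exists>x c. x \<in> carrier G \<and> c \<in> X \<and> v = [elt x, c] \<and> w = [act x c])"
proof
  assume "Q.adjacent v w"
  then obtain l where l: "l \<in> B" "l \<notin> U" "take 2 l = v" "tgt l = w"
    by (auto simp: Q.adjacent_def)
  from l(1,2) show "(\<exists>x c d. x \<in> carrier G \<and> c \<in> X \<and> d \<in> X \<and> (c, d) \<in> r - Id \<and> v = [elt x, c] \<and> w = [elt x, d]) \<or>
    (\<exists>x c. x \<in> carrier G \<and> c \<in> X \<and> v = [elt x, c] \<and> w = [act x c])"
  proof (cases rule: arrow_cases)
    case (order x c d)
    then have "v = [elt x, c]" "w = [elt x, d]"
      using l(3,4) by (auto simp: tgt_def)
    then show ?thesis using order(1-4) by blast
  next
    case (action x c)
    then have "v = [elt x, c]" "w = [act x c]"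
      using l(3,4) by (auto simp: tgt_def)
    then show ?thesis using action(1,2) by blast
  qed
next
  assume "(\<exists>x c d. x \<in> carrier G \<and> c \<in> X \<and> d \<in> X \<and> (c, d) \<in> r - Id \<and> v = [elt x, c] \<and> w = [elt x, d]) \<or>
    (\<exists>x c. x \<in> carrier G \<and> c \<in> X \<and> v = [elt x, c] \<and> w = [act x c])"
  then show "Q.adjacent v w"
  proof (elim disjE exE conjE)
    fix x c d assume *: "x \<in> carrier G" "c \<in> X" "d \<in> X" "(c, d) \<in> r - Id" "v = [elt x, c]" "w = [elt x, d]"
    then have "[elt x, c, d] \<in> B - U"
      unfolding B_def by auto
    then show ?thesis
      unfolding Q.adjacent_def by (rule rev_bexI) (simp add: * tgt_def)
  next
    fix x c assume *: "x \<in> carrier G" "c \<in> X" "v = [elt x, c]" "w = [act x c]"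
    then have "[elt x, c, Inl 0, Inl 0] \<in> B - U"
      unfolding B_def by auto
    then show ?thesis
      unfolding Q.adjacent_def by (rule rev_bexI) (simp add: * tgt_def)
  qed
qed

lemma adjacent_short: "\<not> Q.adjacent [c] w"
  and adjacent_long: "Q.adjacent [elt x, c] [elt y, d] \<longleftrightarrow>
    x \<in> carrier G \<and> c \<in> X \<and> d \<in> X \<and> (c, d) \<in> r - Id \<and> x = y"
  and adjacent_act: "Q.adjacent [elt x, c] [d] \<longleftrightarrow> x \<in> carrier G \<and> c \<in> X \<and> d = act x c"
  by (auto simp: adjacent_cases)

text \<open>The permutation moves whole copies, by a map \<mu> on their indices, and keeps
  positions. The arrows out of the copy of index \<open>\<one>\<close> then determine it on
  \<open>X\<close> as the action of \<open>g = \<mu> \<one>\<close>, and the arrows out of position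
  \<open>elt \<one>\<close> force \<mu> to be left multiplication by \<open>g\<close>.\<close>

lemma quiver_rigid:
  assumes bij: "bij_betw \<sigma> U U"
    and adj: "\<And>v w. v \<in> U \<Longrightarrow> w \<in> U \<Longrightarrow> Q.adjacent (\<sigma> v) (\<sigma> w) \<longleftrightarrow> Q.adjacent v w"
  shows "\<exists>g\<in>carrier G. \<forall>u\<in>U. \<sigma> u = \<phi> g u"
proof -
  have \<sigma>U: "\<sigma> u \<in> U" if "u \<in> U" for u
    using bij that by (auto simp: bij_betw_def)
  \<comment> \<open>\<open>[elt x, c]\<close> has an outgoing arrow, hence so does its image, and
    only vertices of length two have one.\<close>
  have long_image: "\<exists>y d. \<sigma> [elt x, c] = [elt y, d] \<and> y \<in> carrier G \<and> d \<in> X"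
    if "x \<in> carrier G" "c \<in> X" for x c
  proof -
    have "Q.adjacent (\<sigma> [elt x, c]) (\<sigma> [act x c])"
      using that act_closed by (subst adj) (auto simp: adjacent_act)
    then show ?thesis
      using \<sigma>U[of "[elt x, c]"] that by (auto simp: adjacent_cases)
  qed
  then obtain \<tau> \<kappa> where long: "\<And>x c. x \<in> carrier G \<Longrightarrow> c \<in> X \<Longrightarrow>
      \<sigma> [elt x, c] = [elt (\<tau> x c), \<kappa> x c] \<and> \<tau> x c \<in> carrier G \<and> \<kappa> x c \<in> X"
    by metis
  \<comment> \<open>Were the image of length two, it would have an outgoing arrow; by surjectivity
    this could be pulled back to an arrow out of the sink \<open>[c]\<close>.\<close>
  have short_image: "\<exists>d\<in>X. \<sigma> [c] = [d]" if c: "c \<in> X" for c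
  proof (rule ccontr)
    assume no: "\<not> ?thesis"
    have "\<sigma> [c] \<in> U"
      using c by (intro \<sigma>U) simp
    then obtain x d where d: "x \<in> carrier G" "d \<in> X" "\<sigma> [c] = [elt x, d]"
      using no by (cases rule: U_cases) auto
    have "[act x d] \<in> U"
      using act_closed[OF d(1,2)] by simp
    then obtain u where u: "u \<in> U" "\<sigma> u = [act x d]"
      using bij by (metis bij_betw_imp_surj_on imageE)
    have "Q.adjacent [c] u"
      using adj[of "[c]" u] u c d by (simp add: adjacent_act)
    then show False
      by (simp add: adjacent_short)
  qed
  have total: "(c, d) \<in> r - Id \<or> (d, c) \<in> r - Id" if "c \<in> X" "d \<in> X" "c \<noteq> d" for c d
  proof -
    have "total_on X r"
      using well_order unfolding well_order_on_def linear_order_on_def by (elim conjE)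
    then show ?thesis
      using that unfolding total_on_def by blast
  qed
  have step: "\<tau> x c = \<tau> x d \<and> (\<kappa> x c, \<kappa> x d) \<in> r - Id"
    if "x \<in> carrier G" "c \<in> X" "d \<in> X" "(c, d) \<in> r - Id" for x c d
    using adj[of "[elt x, c]" "[elt x, d]"] long[OF that(1,2)] long[OF that(1,3)] that
    by (simp add: adjacent_long)
  \<comment> \<open>Any two distinct points of a copy are joined by an order arrow, and such arrows
    stay inside one copy, so the image of a copy lies in a single copy.\<close>
  have \<tau>: "\<tau> x c = \<tau> x d" if "x \<in> carrier G" "c \<in> X" "d \<in> X" for x c d
    using total[OF that(2,3)] step[OF that] step[OF that(1,3,2)] by metis
  have \<kappa>: "\<kappa> x c = c" if x: "x \<in> carrier G" and c: "c \<in> X" for x c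
  proof (rule well_order_automorphism_trivial[OF well_order _ _ c])
    show "(\<kappa> x a, \<kappa> x b) \<in> r - Id" if "a \<in> X" "b \<in> X" "(a, b) \<in> r - Id" for a b
      using step[OF x that] by blast
    show "bij_betw (\<kappa> x) X X"
    proof (rule bij_betw_imageI)
      show "inj_on (\<kappa> x) X"
      proof (rule inj_onI, rule ccontr)
        fix a b assume ab: "a \<in> X" "b \<in> X" "\<kappa> x a = \<kappa> x b" "a \<noteq> b"
        show False
          using total[OF ab(1,2,4)] step[OF x ab(1,2)] step[OF x ab(2,1)] ab(3) by auto
      qed
      show "\<kappa> x ` X = X"
      proof (intro equalityI subsetI)
        show "a \<in> X" if "a \<in> \<kappa> x ` X" for a
          using that long[OF x] by blast
      next
        fix d assume d: "d \<in> X"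
        show "d \<in> \<kappa> x ` X"
        proof (cases "d = \<kappa> x c")
          case True
          then show ?thesis using c by blast
        next
          \<comment> \<open>A point \<open>d\<close> other than \<open>\<kappa> x c\<close> is
            joined to it inside the target copy. Pulled back, the preimage \<open>u\<close> is
            joined to \<open>[elt x, c]\<close>; it has length two, so it lies in the copy of index
            \<open>x\<close>.\<close>
          case False
          let ?w = "[elt (\<tau> x c), d]"
          have "?w \<in> U"
            using long[OF x c] d by simp
          then obtain u where u: "u \<in> U" "\<sigma> u = ?w"
            using bij by (metis bij_betw_imp_surj_on imageE)
          have \<sigma>c: "\<sigma> [elt x, c] = [elt (\<tau> x c), \<kappa> x c]" "[elt x, c] \<in> U"
            using long[OF x c] x c by auto
          have "Q.adjacent (\<sigma> [elt x, c]) (\<sigma> u) \<or> Q.adjacent (\<sigma> u) (\<sigma> [elt x, c])"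
            using total[of "\<kappa> x c" d] False d long[OF x c] by (simp add: u(2) \<sigma>c(1) adjacent_long)
          then have uc: "Q.adjacent [elt x, c] u \<or> Q.adjacent u [elt x, c]"
            using adj u(1) \<sigma>c(2) by blast
          from u(1) show ?thesis
          proof (cases rule: U_cases)
            case (short b)
            then obtain b' where "\<sigma> u = [b']"
              using short_image[of b] by blast
            then show ?thesis using u(2) by simp
          next
            case u_long: (long y b)
            then have "y = x"
              using uc by (simp only: adjacent_long) blast
            then have "\<kappa> x b = d"
              using u(2) long[OF x u_long(2)] u_long(3) by simp
            then show ?thesis
              using u_long(2) by blast
          qed
        qed
      qed
    qed
  qed
  \<comment> \<open>By \<tau> the position is irrelevant to the index of the image;
    \<open>elt \<one>\<close> is a position that exists even when \<open>V\<close> is empty.\<close>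
  define g where "g = \<tau> \<one> (elt \<one>)"
  define \<mu> where "\<mu> x = \<tau> x (elt \<one>)" for x
  have one: "elt \<one> \<in> X"
    by simp
  have \<mu>: "\<mu> x \<in> carrier G" if "x \<in> carrier G" for x
    using long[OF that one] by (simp only: \<mu>_def)
  have \<sigma>_long: "\<sigma> [elt x, c] = [elt (\<mu> x), c]" if "x \<in> carrier G" "c \<in> X" for x c
    using long[OF that] \<tau>[OF that one] \<kappa>[OF that] by (simp only: \<mu>_def)
  \<comment> \<open>A vertex of length two has exactly one arrow to a vertex of length one, so the
    image of its end is determined by the image of the vertex.\<close>
  have \<sigma>_act: "\<sigma> [act x c] = [act (\<mu> x) c]" if x: "x \<in> carrier G" and c: "c \<in> X" for x c
  proof -
    obtain d where d: "\<sigma> [act x c] = [d]"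
      using short_image[OF act_closed[OF x c]] by blast
    have "Q.adjacent (\<sigma> [elt x, c]) (\<sigma> [act x c])"
      using x c act_closed by (subst adj) (auto simp: adjacent_act)
    then show ?thesis
      by (simp add: d \<sigma>_long[OF x c] adjacent_act)
  qed
  have g: "g \<in> carrier G"
    using \<mu>[of \<one>] by (simp add: g_def \<mu>_def)
  have \<sigma>_short: "\<sigma> [c] = [act g c]" if "c \<in> X" for c
    using \<sigma>_act[of \<one> c] that by (simp add: act_one g_def \<mu>_def)
  \<comment> \<open>At position \<open>elt \<one>\<close> the arrow ends at
    \<open>x \<otimes> \<one> = x\<close>, so \<open>\<sigma> [elt x]\<close> is computed in two
    ways.\<close>
  have "\<mu> x = g \<otimes> x" if x: "x \<in> carrier G" for x
    using \<sigma>_act[of x "elt \<one>"] \<sigma>_short[of "elt x"] x \<mu>[OF x] by simp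
  then have "\<sigma> u = \<phi> g u" if "u \<in> U" for u
    by (cases rule: U_cases[OF that]) (simp_all add: \<sigma>_short \<sigma>_long \<phi>_short \<phi>_long)
  then show ?thesis
    using g by blast
qed

abbreviation "W \<equiv> (\<lambda>v. [pt v]) ` V"

sublocale Q: rigid_quiver_action K B U "take 2" tgt G \<phi> W
proof (unfold_locales, goal_cases)
  case 1
  then show ?case by auto
next
  case (2 g w)
  then show ?case by (auto simp: \<phi>_short \<rho>_closed)
next
  case (3 g h)
  \<comment> \<open>Left translation is free, so the single vertex \<open>[elt \<one>]\<close>,
    which is outside \<open>W\<close>, separates group elements whatever \<rho> is.\<close>
  have "\<phi> g [elt \<one>] = \<phi> h [elt \<one>]"
    by (rule 3(3)) auto
  then show ?case
    using 3(1,2) by (simp add: \<phi>_short)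
next
  case (4 \<sigma>)
  then show ?case by (rule quiver_rigid)
qed

end

theorem theorem1p3:
  fixes G :: "('g, 'm) monoid_scheme"
    and K :: "('k, 'n) ring_scheme"
    and V :: "'v set"
    and \<rho> :: "'g \<Rightarrow> 'v \<Rightarrow> 'v"
  assumes "group G" and "field K" and "group_action G V \<rho>"
  shows "\<exists>(C :: ('k, (nat + 'g + 'v) list \<Rightarrow> 'k) coalgebra) \<alpha>.
    G_coalgebra G K C \<alpha> \<and>
    \<alpha> \<in> mon G (coalg_Aut K C) \<and>
    grouplike_restriction K C \<circ> \<alpha> \<in>
      iso G (BijGroup (grouplikes K C)
        \<lparr>carrier := grouplike_restriction K C ` carrier (coalg_Aut K C)\<rparr>) \<and>
    (\<exists>\<iota>. inj_on \<iota> V \<and> \<iota> ` V \<subseteq> grouplikes K C \<and>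
      (\<forall>f\<in>carrier (coalg_Aut K C). f ` (\<iota> ` V) = \<iota> ` V) \<and>
      (\<forall>g\<in>carrier G. transport_action \<iota> V \<rho> g = restrict (\<alpha> g) (\<iota> ` V)) \<and>
      (\<exists>\<rho>'. faithful_action G (grouplikes K C - \<iota> ` V) \<rho>' \<and>
        (\<forall>g\<in>carrier G. grouplike_restriction K C (\<alpha> g) =
          sum_action (\<iota> ` V) (transport_action \<iota> V \<rho>) (grouplikes K C - \<iota> ` V) \<rho>' g)))"
proof -
  obtain r :: "(nat + 'g + 'v) rel" where "well_order_on (Inr ` Sum_Type.Plus (carrier G) V) r"
    using well_order_on by blast
  then interpret permutation_coalgebra G V \<rho> r K
    by (intro permutation_coalgebra.intro permutation_quiver.intro permutation_quiver_axioms.intro assms)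
  have "inj_on (\<lambda>v. [pt v]) V" "\<And>g v. g \<in> carrier G \<Longrightarrow> v \<in> V \<Longrightarrow> \<phi> g [pt v] = [pt (\<rho> g v)]"
    by (auto simp: inj_on_def \<phi>_short)
  note realization = Q.realization[OF this(1) refl \<rho>_closed this(2)]
  show ?thesis
    by (rule exI[of _ Q.C], rule exI[of _ Q.\<alpha>])
      (intro conjI Q.G_coalgebra_quiver Q.\<alpha>_mon Q.restriction_iso realization)
qed

end
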